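(* Let $n\ge2$, $\alpha>0$, $m\in(0,3)$, $\theta\in(0,1)$, and let $s>0$ satisfy \[ s<\left[\frac{(3-m)^4(1-\theta)^\alpha}{64(1+m)}\right]^{\frac1{3-m}} . \] Then for every $\eta\in(0,1)$ there is a (sufficiently small) constant $\mu_0=\mu_0(\alpha,m,\theta,s,\eta)>0$, depending only on the indicated quantities, such that the following holds. Let $h\in C(B_1)\cap L^\infty(B_1)$ with $h\le0$, and let $u\in C(B_1)$ be a nonnegative viscosity solution of \[ \Delta_\infty u=|x|^\alpha u_+^m+h(x)\quad\text{in }B_1 . \] Assume that $0\in\partial\{u>0\}$ and $0\in\overline{\{u>0\}\cap\{h=0\}}$. Assume further that for every $x_0\in\{u>0\}\cap\{h=0\}$, \[ 0\ge h(x)\ge -s^m\left[(1-\theta)^\alpha-\frac{64(1+m)}{(3-m)^4}s^{3-m}\right]|x_0|^{\frac{3\alpha}{3-m}}|x-x_0|^{\frac{4m}{3-m}} \] for every $x\in B_{\theta|x_0|}(x_0)\cap B_1$. Assume moreover that for every $\eta\in(0,1)$ there exists $r_\eta\in(0,1)$ such that \[ 0\ge h(x)\ge-\mu_0(\alpha,m,\theta,s,\eta)\,|x|^{\frac{3\alpha+4m}{3-m}}\qquad\text{for every }x\in B_{r_\eta}. \] Then for every $\eta\in(0,1)$ and every $r\in(0,r_\eta)$, \[ \sup_{\partial B_r}u\ \ge\ \eta\left(\frac{(3-m)^4}{(4+\alpha)^3(1+\alpha+m)}\right)^{\frac1{3-m}} r^{\frac{4+\alpha}{3-m}} . \]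
   Context: $B_r(x_0)$ is the open ball in $\mathbb{R}^n$ of radius $r$ centered at $x_0$, and $B_r=B_r(0)$. The infinity Laplacian is $\Delta_\infty w=\langle D^2w\,Dw,Dw\rangle=\sum_{i,j}\partial_i w\,\partial_{ij}w\,\partial_j w$, and $t_+=\max\{t,0\}$. A function $u\in C(B_1)$ is a viscosity subsolution (resp. supersolution) of $\Delta_\infty u=|x|^\alpha u_+^m+h(x)$ in $B_1$ if, whenever $\varphi\in C^2(B_1)$ and $u-\varphi$ has a local maximum (resp. minimum) at $x_0\in B_1$, one has $\Delta_\infty\varphi(x_0)\ge|x_0|^\alpha(u(x_0)_+)^m+h(x_0)$ (resp. $\le$). It is a viscosity solution if it is both. $\{u>0\}=\{x\in B_1:u(x)>0\}$ and $\{h=0\}=\{x\in B_1:h(x)=0\}$. *)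

theory Defs
  imports "HOL-Analysis.Analysis"
begin

text \<open>
  The dimension \<open>n\<close> has to be quantified inside a formula, so \<open>\<real>\<^sup>n\<close> is the library's
  \<^const>\<open>Euclidean_space\<close> \<open>n\<close>, whose points are the \<open>x :: nat \<Rightarrow> real\<close> with \<open>x i = 0\<close> for \<open>i \<ge> n\<close>.
  All topological notions are taken in this abstract topology: the type-class topology of
  \<^typ>\<open>nat \<Rightarrow> real\<close> would give interiors and boundaries in an infinite-dimensional space.
\<close>

definition rn_dist :: "nat \<Rightarrow> (nat \<Rightarrow> real) \<Rightarrow> (nat \<Rightarrow> real) \<Rightarrow> real" where
  "rn_dist n x y = L2_set (\<lambda>i. x i - y i) {..<n}"

abbreviation rn_norm :: "nat \<Rightarrow> (nat \<Rightarrow> real) \<Rightarrow> real" where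
  "rn_norm n x \<equiv> L2_set x {..<n}"

definition rn_ball :: "nat \<Rightarrow> (nat \<Rightarrow> real) \<Rightarrow> real \<Rightarrow> (nat \<Rightarrow> real) set" where
  "rn_ball n x0 r = {x \<in> topspace (Euclidean_space n). rn_dist n x x0 < r}"

definition rn_sphere :: "nat \<Rightarrow> (nat \<Rightarrow> real) \<Rightarrow> real \<Rightarrow> (nat \<Rightarrow> real) set" where
  "rn_sphere n x0 r = {x \<in> topspace (Euclidean_space n). rn_dist n x x0 = r}"

abbreviation origin :: "nat \<Rightarrow> real" where
  "origin \<equiv> \<lambda>_. 0"

definition rn_cont :: "nat \<Rightarrow> (nat \<Rightarrow> real) set \<Rightarrow> ((nat \<Rightarrow> real) \<Rightarrow> real) \<Rightarrow> bool" where
  "rn_cont n U f \<longleftrightarrow> continuous_map (subtopology (Euclidean_space n) U) euclideanreal f"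

definition partial :: "nat \<Rightarrow> ((nat \<Rightarrow> real) \<Rightarrow> real) \<Rightarrow> (nat \<Rightarrow> real) \<Rightarrow> real" where
  "partial i f x = deriv (\<lambda>t. f (x(i := t))) (x i)"

text \<open>
  The class \<open>C\<^sup>k(U)\<close> for open \<open>U\<close>: all partial derivatives of order at most \<open>k\<close> exist and are
  continuous on \<open>U\<close>.  Openness of \<open>U\<close> makes these derivatives independent of the values of
  \<open>f\<close> outside \<open>U\<close>.
\<close>

primrec Ck_on :: "nat \<Rightarrow> (nat \<Rightarrow> real) set \<Rightarrow> nat \<Rightarrow> ((nat \<Rightarrow> real) \<Rightarrow> real) \<Rightarrow> bool" where
  "Ck_on n U 0 f \<longleftrightarrow> rn_cont n U f"
| "Ck_on n U (Suc k) f \<longleftrightarrow> rn_cont n U f \<and>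
     (\<forall>i<n. (\<forall>x\<in>U. (\<lambda>t. f (x(i := t))) differentiable at (x i)) \<and> Ck_on n U k (partial i f))"

definition inf_laplacian :: "nat \<Rightarrow> ((nat \<Rightarrow> real) \<Rightarrow> real) \<Rightarrow> (nat \<Rightarrow> real) \<Rightarrow> real" where
  "inf_laplacian n w x =
     (\<Sum>i<n. \<Sum>j<n. partial i w x * partial i (partial j w) x * partial j w x)"

definition local_max_at :: "nat \<Rightarrow> (nat \<Rightarrow> real) set \<Rightarrow> ((nat \<Rightarrow> real) \<Rightarrow> real) \<Rightarrow> (nat \<Rightarrow> real) \<Rightarrow> bool" where
  "local_max_at n U f x0 \<longleftrightarrow> x0 \<in> U \<and> (\<exists>\<epsilon>>0. \<forall>x\<in>rn_ball n x0 \<epsilon> \<inter> U. f x \<le> f x0)"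

definition local_min_at :: "nat \<Rightarrow> (nat \<Rightarrow> real) set \<Rightarrow> ((nat \<Rightarrow> real) \<Rightarrow> real) \<Rightarrow> (nat \<Rightarrow> real) \<Rightarrow> bool" where
  "local_min_at n U f x0 \<longleftrightarrow> x0 \<in> U \<and> (\<exists>\<epsilon>>0. \<forall>x\<in>rn_ball n x0 \<epsilon> \<inter> U. f x0 \<le> f x)"

definition viscosity_subsolution ::
  "nat \<Rightarrow> real \<Rightarrow> real \<Rightarrow> ((nat \<Rightarrow> real) \<Rightarrow> real) \<Rightarrow> ((nat \<Rightarrow> real) \<Rightarrow> real) \<Rightarrow> bool" where
  "viscosity_subsolution n \<alpha> m h u \<longleftrightarrow>
     rn_cont n (rn_ball n origin 1) u \<and>
     (\<forall>\<phi> x0. Ck_on n (rn_ball n origin 1) 2 \<phi> \<and>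
        local_max_at n (rn_ball n origin 1) (\<lambda>x. u x - \<phi> x) x0 \<longrightarrow>
        inf_laplacian n \<phi> x0 \<ge> rn_norm n x0 powr \<alpha> * max (u x0) 0 powr m + h x0)"

definition viscosity_supersolution ::
  "nat \<Rightarrow> real \<Rightarrow> real \<Rightarrow> ((nat \<Rightarrow> real) \<Rightarrow> real) \<Rightarrow> ((nat \<Rightarrow> real) \<Rightarrow> real) \<Rightarrow> bool" where
  "viscosity_supersolution n \<alpha> m h u \<longleftrightarrow>
     rn_cont n (rn_ball n origin 1) u \<and>
     (\<forall>\<phi> x0. Ck_on n (rn_ball n origin 1) 2 \<phi> \<and>
        local_min_at n (rn_ball n origin 1) (\<lambda>x. u x - \<phi> x) x0 \<longrightarrow>
        inf_laplacian n \<phi> x0 \<le> rn_norm n x0 powr \<alpha> * max (u x0) 0 powr m + h x0)"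

definition viscosity_solution ::
  "nat \<Rightarrow> real \<Rightarrow> real \<Rightarrow> ((nat \<Rightarrow> real) \<Rightarrow> real) \<Rightarrow> ((nat \<Rightarrow> real) \<Rightarrow> real) \<Rightarrow> bool" where
  "viscosity_solution n \<alpha> m h u \<longleftrightarrow>
     viscosity_subsolution n \<alpha> m h u \<and> viscosity_supersolution n \<alpha> m h u"

definition positivity_set :: "nat \<Rightarrow> ((nat \<Rightarrow> real) \<Rightarrow> real) \<Rightarrow> (nat \<Rightarrow> real) set" where
  "positivity_set n u = {x \<in> rn_ball n origin 1. u x > 0}"

definition zero_set :: "nat \<Rightarrow> ((nat \<Rightarrow> real) \<Rightarrow> real) \<Rightarrow> (nat \<Rightarrow> real) set" where
  "zero_set n h = {x \<in> rn_ball n origin 1. h x = 0}"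

end

theory Submission
  imports Defs
begin

text \<open>
  Put \<open>\<beta> = (4 + \<alpha>) / (3 - m)\<close>, \<open>p = 4 / (3 - m)\<close> and let \<open>C\<close> be the constant of the theorem, so that
  \<open>C\<^sup>3 \<beta>\<^sup>3 (\<beta> - 1) = C powr m\<close>, that is, \<open>C |x| powr \<beta>\<close> solves the equation with \<open>h = 0\<close>.  The
  subsolution \<open>u\<close> is compared with explicit radial functions throughout, so that no comparison
  principle between two viscosity functions enters.

  First, \<open>u\<close> has growth of order at least \<open>\<beta>\<close> along some sequence of points.  Let \<open>x0\<close> be close to the
  origin with \<open>u x0 > 0\<close> and \<open>h x0 = 0\<close>.  The lower bound on \<open>h\<close> near \<open>x0\<close> makes
  \<open>\<psi>(x) = s |x0| powr (\<alpha> / (3 - m)) |x - x0| powr p\<close> a supersolution there.  Since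
  \<open>u x0 > 0 = \<psi> x0\<close>, the maximum of \<open>u - \<psi>\<close> over a ball about \<open>x0\<close> is positive and is attained on the
  bounding sphere (lemma \<open>subsolution_exceeds_barrier_on_sphere\<close>).  The centre needs an argument of its own,
  because \<open>\<psi>\<close> need not be twice differentiable there (lemma \<open>subsolution_no_power_peak\<close>).  Hence
  \<open>u > \<kappa> |x| powr \<beta>\<close> at points \<open>x\<close> arbitrarily close to the origin, with an explicit \<open>\<kappa> > 0\<close>
  (lemma \<open>positive_near_origin\<close>).

  Next, put \<open>c = \<eta> * C\<close> and suppose that \<open>sup u < c r powr \<beta>\<close> on the sphere of radius \<open>r\<close>.  If \<open>\<mu>\<close> is small,
  \<open>c |x| powr \<beta>\<close> is still a supersolution for the given \<open>h\<close>, hence \<open>u \<le> c |x| powr \<beta>\<close> in the ball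
  (lemma \<open>subsolution_le_power_barrier\<close>).  Therefore \<open>L = limsup u / |x| powr \<beta>\<close> at the origin lies in
  \<open>[\<kappa>, c]\<close>.  Testing with a slowly varying multiple of \<open>|x| powr \<beta>\<close> on an annulus on which
  \<open>u / |x| powr \<beta>\<close> nearly reaches \<open>L\<close> yields \<open>L powr m - \<mu> \<le> L\<^sup>3 \<beta>\<^sup>3 (\<beta> - 1)\<close>
  (lemma \<open>subsolution_asymptotic_ratio\<close>).  The right-hand side is
  \<open>L powr m * (L / C) powr (3 - m) \<le> L powr m * \<eta> powr (3 - m)\<close>, which is a contradiction as soon as
  \<open>\<mu> < min \<kappa> c powr m * (1 - \<eta> powr (3 - m))\<close>; \<open>\<mu>0 \<eta>\<close> is half of this bound.
\<close>

section \<open>Topology of the space\<close>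

lemma rn_cont_iff_continuous_on:
  "rn_cont n U f \<longleftrightarrow> continuous_on (topspace (Euclidean_space n) \<inter> U) f"
proof -
  have E: "Euclidean_space n = top_of_set {x. \<forall>i\<ge>n. x i = 0}"
    by (simp add: Euclidean_space_def euclidean_product_topology)
  show ?thesis
    unfolding rn_cont_def E by (simp add: subtopology_subtopology)
qed

lemma rn_dist_sq: "(rn_dist n x y)\<^sup>2 = (\<Sum>i<n. (x i - y i)\<^sup>2)"
  by (simp add: rn_dist_def L2_set_def sum_nonneg)

lemma rn_dist_nonneg [simp]: "0 \<le> rn_dist n x y"
  by (simp add: rn_dist_def)

lemma rn_dist_self [simp]: "rn_dist n x x = 0"
  by (simp add: rn_dist_def L2_set_def)

lemma rn_dist_origin [simp]: "rn_dist n x origin = rn_norm n x"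
  by (simp add: rn_dist_def)

lemma rn_dist_commute: "rn_dist n x y = rn_dist n y x"
  by (simp add: rn_dist_def L2_set_def power2_commute)

lemma rn_dist_triangle: "rn_dist n x z \<le> rn_dist n x y + rn_dist n y z"
  using L2_set_triangle_ineq[of "\<lambda>i. x i - y i" "\<lambda>i. y i - z i" "{..<n}"]
  by (simp add: rn_dist_def)

lemma rn_norm_triangle: "rn_norm n x \<le> rn_dist n x y + rn_norm n y"
  using rn_dist_triangle[of n x origin y] by simp

lemma rn_dist_eq_0:
  assumes "x \<in> topspace (Euclidean_space n)" "y \<in> topspace (Euclidean_space n)" "rn_dist n x y = 0"
  shows "x = y"
proof
  fix i
  have "\<forall>i<n. x i = y i"
    using assms(3) by (auto simp: rn_dist_def L2_set_eq_0_iff)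
  then show "x i = y i"
    using assms(1,2) by (cases "i < n") (auto simp: topspace_Euclidean_space)
qed

lemma origin_in_space [simp]: "origin \<in> topspace (Euclidean_space n)"
  by (simp add: topspace_Euclidean_space)

lemma rn_norm_pos:
  assumes "x \<in> topspace (Euclidean_space n)" "x \<noteq> origin"
  shows "rn_norm n x > 0"
  using rn_dist_eq_0[OF assms(1) origin_in_space[of n]] assms(2)
  by (metis L2_set_nonneg order_le_less rn_dist_origin)

lemma continuous_on_coord: "continuous_on S (\<lambda>x::nat \<Rightarrow> real. x i)"
  by (rule continuous_on_subset[OF continuous_on_product_coordinates subset_UNIV])

lemma continuous_on_rn_dist: "continuous_on S (\<lambda>x. rn_dist n x y)"
  unfolding rn_dist_def L2_set_def
  by (intro continuous_on_real_sqrt continuous_on_sum continuous_on_power continuous_on_diff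
      continuous_on_const continuous_on_coord)

text \<open>The closed ball in \<open>\<real>\<^sup>n\<close>, as a set of functions on \<^typ>\<open>nat\<close> vanishing from \<open>n\<close> on.\<close>

definition rn_cball :: "nat \<Rightarrow> (nat \<Rightarrow> real) \<Rightarrow> real \<Rightarrow> (nat \<Rightarrow> real) set" where
  "rn_cball n x0 r = {x \<in> topspace (Euclidean_space n). rn_dist n x x0 \<le> r}"

text \<open>A closed ball is a closed subset of a product of compact intervals.\<close>

lemma compact_rn_cball: "compact (rn_cball n x0 r)"
proof -
  define I where "I i = (if i < n then {x0 i - r..x0 i + r} else {0})" for i
  have "compactin (product_topology (\<lambda>i. euclideanreal) UNIV) (PiE UNIV I)"
    by (subst compactin_PiE) (auto simp: I_def)
  then have cI: "compact (PiE UNIV I)"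
    by (simp add: euclidean_product_topology)
  have "x i \<in> I i" if "x \<in> rn_cball n x0 r" for x i
  proof (cases "i < n")
    case True
    have "\<bar>x i - x0 i\<bar> = sqrt ((x i - x0 i)\<^sup>2)" by simp
    also have "\<dots> \<le> rn_dist n x x0"
      unfolding rn_dist_def L2_set_def
      by (intro real_sqrt_le_mono member_le_sum) (use True in auto)
    also have "\<dots> \<le> r" using that by (simp add: rn_cball_def)
    finally show ?thesis using True by (auto simp: I_def)
  next
    case False
    then show ?thesis using that by (auto simp: I_def rn_cball_def topspace_Euclidean_space)
  qed
  then have sub: "rn_cball n x0 r \<subseteq> PiE UNIV I" by auto
  have cs: "closed (topspace (Euclidean_space n))"
    using closedin_Euclidean_imp_closed closedin_topspace by blast
  have "closed {x. rn_dist n x x0 \<le> r}"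
    by (intro closed_Collect_le continuous_on_rn_dist continuous_on_const)
  then have "closed (topspace (Euclidean_space n) \<inter> {x. rn_dist n x x0 \<le> r})"
    using cs by blast
  moreover have "topspace (Euclidean_space n) \<inter> {x. rn_dist n x x0 \<le> r} = rn_cball n x0 r"
    by (auto simp: rn_cball_def)
  ultimately have "closed (rn_cball n x0 r)" by simp
  then show ?thesis
    using cI sub compact_Int_closed[of "PiE UNIV I" "rn_cball n x0 r"] by (simp add: Int_absorb1)
qed

lemma openin_Euclidean_space_iff:
  "openin (Euclidean_space n) S \<longleftrightarrow> (\<exists>T. open T \<and> S = topspace (Euclidean_space n) \<inter> T)"
  by (auto simp: Euclidean_space_def euclidean_product_topology openin_open)

lemma openin_rn_ball: "openin (Euclidean_space n) (rn_ball n x0 r)"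
proof -
  have "open {x. rn_dist n x x0 < r}"
    by (intro open_Collect_less continuous_on_rn_dist continuous_on_const)
  then show ?thesis
    unfolding openin_Euclidean_space_iff by (auto simp: rn_ball_def)
qed

text \<open>The distance generates the topology: on the compact set of points of a closed ball outside
  \<open>S\<close>, the distance to the centre attains a positive minimum.\<close>

lemma openin_contains_rn_ball:
  assumes "openin (Euclidean_space n) S" "x0 \<in> S"
  obtains e where "e > 0" "rn_ball n x0 e \<subseteq> S"
proof -
  obtain T where T: "open T" "S = topspace (Euclidean_space n) \<inter> T"
    using assms(1) openin_Euclidean_space_iff by blast
  have x0: "x0 \<in> topspace (Euclidean_space n)" using T assms by blast
  have K: "compact (rn_cball n x0 1 - T)"
    using compact_diff compact_rn_cball T(1) by blast
  show ?thesis
  proof (cases "rn_cball n x0 1 - T = {}")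
    case True
    then have "rn_ball n x0 1 \<subseteq> S"
      using T(2) by (force simp: rn_ball_def rn_cball_def)
    then show ?thesis using that[of 1] by simp
  next
    case False
    obtain z where z: "z \<in> rn_cball n x0 1 - T"
      and zmin: "\<And>x. x \<in> rn_cball n x0 1 - T \<Longrightarrow> rn_dist n z x0 \<le> rn_dist n x x0"
      using continuous_attains_inf[OF K False continuous_on_rn_dist] by blast
    have "z \<noteq> x0" using z T assms(2) by blast
    then have pos: "rn_dist n z x0 > 0"
      using z x0 rn_dist_eq_0[of z n x0] rn_dist_nonneg[of n z x0] by (auto simp: rn_cball_def less_le)
    have "rn_ball n x0 (min 1 (rn_dist n z x0)) \<subseteq> S"
    proof
      fix x assume x: "x \<in> rn_ball n x0 (min 1 (rn_dist n z x0))"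
      then have "x \<in> T"
        using zmin[of x] by (force simp: rn_ball_def rn_cball_def)
      then show "x \<in> S" using x T(2) by (simp add: rn_ball_def)
    qed
    then show ?thesis using that[of "min 1 (rn_dist n z x0)"] pos by simp
  qed
qed

lemma rn_cont_greater_openin:
  assumes "openin (Euclidean_space n) U" "rn_cont n U f"
  shows "openin (Euclidean_space n) {x \<in> U. f x > a}"
proof -
  have "openin (subtopology (Euclidean_space n) U)
      {x \<in> topspace (subtopology (Euclidean_space n) U). f x \<in> {a<..}}"
    using assms(2) unfolding rn_cont_def
    by (rule openin_continuous_map_preimage) simp
  moreover have "{x \<in> topspace (subtopology (Euclidean_space n) U). f x \<in> {a<..}} = {x \<in> U. f x > a}"
    using openin_subset[OF assms(1)] by auto
  ultimately show ?thesis using assms(1) openin_trans_full by fastforce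
qed

lemma rn_cont_imp_continuous_on:
  assumes "rn_cont n U f" "K \<subseteq> U" "K \<subseteq> topspace (Euclidean_space n)"
  shows "continuous_on K f"
  using assms unfolding rn_cont_iff_continuous_on by (meson continuous_on_subset le_inf_iff)

lemma rn_cont_attains_sup:
  assumes "rn_cont n U f" "K \<subseteq> U" "K \<subseteq> topspace (Euclidean_space n)" "compact K" "K \<noteq> {}"
    and "continuous_on K g"
  obtains x where "x \<in> K" "\<And>y. y \<in> K \<Longrightarrow> f y - g y \<le> f x - g x"
proof -
  have "continuous_on K f"
    using assms(1,2,3) by (rule rn_cont_imp_continuous_on)
  then have "continuous_on K (\<lambda>x. f x - g x)"
    using assms(6) by (intro continuous_on_diff)
  then show ?thesis
    using continuous_attains_sup[OF assms(4,5)] that by blast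
qed

section \<open>Testing with radial functions\<close>

text \<open>The test functions are the quadratic polynomials in \<open>|x - y|\<^sup>2\<close>, which are smooth also at
  \<open>x = y\<close>.\<close>

lemma partial_quadratic_in_sq:
  fixes x y :: "nat \<Rightarrow> real"
  assumes "i < n"
  shows "((\<lambda>t. a + b * (\<Sum>j<n. ((x(i := t)) j - y j)\<^sup>2) + c * (\<Sum>j<n. ((x(i := t)) j - y j)\<^sup>2)\<^sup>2)
     has_field_derivative 2 * (x i - y i) * (b + 2 * c * (\<Sum>j<n. (x j - y j)\<^sup>2))) (at (x i))"
proof -
  have *: "((\<lambda>t. \<Sum>j<n. ((x(i := t)) j - y j)\<^sup>2) has_field_derivative 2 * (x i - y i)) (at (x i))"
  proof -
    have "(\<Sum>j<n. ((x(i := t)) j - y j)\<^sup>2) = (\<Sum>j\<in>{..<n} - {i}. (x j - y j)\<^sup>2) + (t - y i)\<^sup>2" for t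
    proof -
      have "(\<Sum>j<n. ((x(i := t)) j - y j)\<^sup>2)
          = (t - y i)\<^sup>2 + (\<Sum>j\<in>{..<n} - {i}. ((x(i := t)) j - y j)\<^sup>2)"
        using assms by (subst sum.remove[of _ i]) auto
      also have "(\<Sum>j\<in>{..<n} - {i}. ((x(i := t)) j - y j)\<^sup>2) = (\<Sum>j\<in>{..<n} - {i}. (x j - y j)\<^sup>2)"
        by (intro sum.cong) auto
      finally show ?thesis by simp
    qed
    then show ?thesis
      by (simp only:) (auto intro!: derivative_eq_intros)
  qed
  have chain: "((\<lambda>t. a + b * f t + c * (f t)\<^sup>2) has_field_derivative 2 * d * (b + 2 * c * f t0)) (at t0)"
    if "(f has_field_derivative 2 * d) (at t0)" for f :: "real \<Rightarrow> real" and d t0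
    by (auto intro!: derivative_eq_intros that simp: algebra_simps)
  show ?thesis
    using chain[OF *] by simp
qed

lemma deriv_partial_quadratic_in_sq:
  fixes x y :: "nat \<Rightarrow> real"
  assumes "i < n"
  shows "((\<lambda>t. 2 * ((x(i := t)) k - y k) * (b + 2 * c * (\<Sum>j<n. ((x(i := t)) j - y j)\<^sup>2)))
     has_field_derivative (if i = k then 2 else 0) * (b + 2 * c * (\<Sum>j<n. (x j - y j)\<^sup>2))
        + 8 * c * (x i - y i) * (x k - y k)) (at (x i))"
proof -
  have 1: "((\<lambda>t. b + 2 * c * (\<Sum>j<n. ((x(i := t)) j - y j)\<^sup>2)) has_field_derivative
      2 * (x i - y i) * (2 * c)) (at (x i))"
    using partial_quadratic_in_sq[OF assms, where a = b and b = "2*c" and c = 0 and x=x and y=y] by simp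
  have 2: "((\<lambda>t. 2 * ((x(i := t)) k - y k)) has_field_derivative (if i = k then 2 else 0)) (at (x i))"
    by (cases "i = k") (auto intro!: derivative_eq_intros)
  show ?thesis
    using DERIV_mult[OF 2 1] by (simp add: algebra_simps)
qed

lemma
  fixes n :: nat and y :: "nat \<Rightarrow> real" and a b c :: real
  defines "\<phi> \<equiv> \<lambda>x. a + b * (\<Sum>j<n. (x j - y j)\<^sup>2) + c * (\<Sum>j<n. (x j - y j)\<^sup>2)\<^sup>2"
  shows Ck_on_quadratic_in_sq: "Ck_on n U 2 \<phi>"
    and inf_laplacian_quadratic_in_sq:
      "inf_laplacian n \<phi> x = 8 * (rn_dist n x y)\<^sup>2 * (b + 2 * c * (rn_dist n x y)\<^sup>2) ^ 3
         + 16 * ((rn_dist n x y)\<^sup>2)\<^sup>2 * (b + 2 * c * (rn_dist n x y)\<^sup>2)\<^sup>2 * (2 * c)"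
proof -
  have p1: "partial i \<phi> = (\<lambda>x. 2 * (x i - y i) * (b + 2 * c * (\<Sum>j<n. (x j - y j)\<^sup>2)))"
    and d1: "(\<lambda>t. \<phi> (x(i := t))) differentiable at (x i)" if "i < n" for i x
    using partial_quadratic_in_sq[OF that, of a b _ y c] unfolding \<phi>_def
    by (auto simp: partial_def fun_eq_iff DERIV_imp_deriv real_differentiable_def)
  have p2: "partial i (partial k \<phi>) x = (if i = k then 2 else 0) * (b + 2 * c * (\<Sum>j<n. (x j - y j)\<^sup>2))
        + 8 * c * (x i - y i) * (x k - y k)"
    and d2: "(\<lambda>t. partial k \<phi> (x(i := t))) differentiable at (x i)" if "i < n" "k < n" for i k x
    using deriv_partial_quadratic_in_sq[OF that(1), of _ k y b c]
    unfolding p1[OF that(2)]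
    by (auto simp: partial_def[of i "\<lambda>x. _ x"] DERIV_imp_deriv real_differentiable_def)
  have c0: "rn_cont n U \<phi>"
    unfolding rn_cont_iff_continuous_on \<phi>_def
    by (intro continuous_on_add continuous_on_mult continuous_on_sum continuous_on_power
      continuous_on_diff continuous_on_const continuous_on_coord)
  have c1: "rn_cont n U (partial i \<phi>)" if "i < n" for i
    unfolding rn_cont_iff_continuous_on p1[OF that]
    by (intro continuous_on_add continuous_on_mult continuous_on_sum continuous_on_power
      continuous_on_diff continuous_on_const continuous_on_coord)
  have c2: "rn_cont n U (partial i (partial k \<phi>))" if "i < n" "k < n" for i k
  proof -
    have "partial i (partial k \<phi>) = (\<lambda>x. (if i = k then 2 else 0) * (b + 2 * c * (\<Sum>j<n. (x j - y j)\<^sup>2))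
        + 8 * c * (x i - y i) * (x k - y k))"
      using p2[OF that] by blast
    then show ?thesis
      unfolding rn_cont_iff_continuous_on by (simp only:)
        (intro continuous_on_add continuous_on_mult continuous_on_sum continuous_on_power
          continuous_on_diff continuous_on_const continuous_on_coord)
  qed
  show "Ck_on n U 2 \<phi>"
    using c0 c1 c2 d1 d2 by (simp add: numeral_2_eq_2)
  define S where "S = (\<Sum>j<n. (x j - y j)\<^sup>2)"
  define B where "B = b + 2 * c * S"
  have S: "(\<Sum>i<n. (x i - y i) * (x i - y i)) = S" by (simp add: S_def power2_eq_square)
  have dbl: "(\<Sum>i<n. \<Sum>j<n. k * (f i * f j)) = k * ((\<Sum>i<n. f i) * (\<Sum>i<n. f i))"
    for k :: real and f :: "nat \<Rightarrow> real"
    by (subst sum_product) (simp only: sum_distrib_left)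
  have "inf_laplacian n \<phi> x = (\<Sum>i<n. \<Sum>j<n. 2 * (x i - y i) * B *
      ((if i = j then 2 else 0) * B + 8 * c * (x i - y i) * (x j - y j)) * (2 * (x j - y j) * B))"
    unfolding inf_laplacian_def B_def S_def
    by (intro sum.cong refl) (simp add: p2, simp add: p1)
  also have "\<dots> = (\<Sum>i<n. \<Sum>j<n. (if i = j then 8 * B^3 * ((x i - y i) * (x i - y i)) else 0) +
      32 * c * B\<^sup>2 * (((x i - y i) * (x i - y i)) * ((x j - y j) * (x j - y j))))"
    by (intro sum.cong refl) (auto simp: algebra_simps power2_eq_square power3_eq_cube)
  also have "\<dots> = (\<Sum>i<n. 8 * B^3 * ((x i - y i) * (x i - y i))) +
      32 * c * B\<^sup>2 * ((\<Sum>i<n. (x i - y i) * (x i - y i)) * (\<Sum>i<n. (x i - y i) * (x i - y i)))"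
    by (simp add: sum.distrib dbl)
  also have "\<dots> = 8 * B^3 * S + 32 * c * B\<^sup>2 * (S * S)"
    unfolding sum_distrib_left[symmetric] S ..
  also have "\<dots> = 8 * S * B^3 + 16 * S\<^sup>2 * B\<^sup>2 * (2 * c)"
    by (simp add: power2_eq_square)
  finally show "inf_laplacian n \<phi> x = 8 * (rn_dist n x y)\<^sup>2 * (b + 2 * c * (rn_dist n x y)\<^sup>2) ^ 3
         + 16 * ((rn_dist n x y)\<^sup>2)\<^sup>2 * (b + 2 * c * (rn_dist n x y)\<^sup>2)\<^sup>2 * (2 * c)"
    unfolding rn_dist_sq B_def S_def .
qed

text \<open>Taylor's theorem with Peano remainder: the term \<open>\<delta>\<close> absorbs the remainder, so no continuity of the
  second derivative is needed.\<close>

lemma quadratic_upper_bound_at: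
  fixes q q' :: "real \<Rightarrow> real"
  assumes "d > 0" "\<And>t. \<bar>t - t0\<bar> < d \<Longrightarrow> (q has_real_derivative q' t) (at t)"
    and q2: "(q' has_real_derivative q2) (at t0)" and "\<delta> > 0"
  obtains e where "e > 0"
    "\<And>t. \<bar>t - t0\<bar> < e \<Longrightarrow> q t \<le> q t0 + q' t0 * (t - t0) + (q2 + \<delta>) / 2 * (t - t0)\<^sup>2"
proof -
  define g where "g t = q' t - q' t0 - (q2 + \<delta>) * (t - t0)" for t
  define r where "r t = q t - (q t0 + q' t0 * (t - t0) + (q2 + \<delta>) / 2 * (t - t0)\<^sup>2)" for t
  have dr: "(r has_real_derivative g t) (at t)" if "\<bar>t - t0\<bar> < d" for t
    unfolding r_def g_def
    by (auto intro!: derivative_eq_intros assms(2) that simp: field_simps)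
  have dg: "(g has_real_derivative - \<delta>) (at t0)"
    unfolding g_def by (auto intro!: derivative_eq_intros q2)
  obtain d1 where d1: "d1 > 0" "\<And>h. 0 < h \<Longrightarrow> h < d1 \<Longrightarrow> g (t0 + h) < g t0"
    using DERIV_neg_dec_right[OF dg] \<open>\<delta> > 0\<close> by auto
  obtain d2 where d2: "d2 > 0" "\<And>h. 0 < h \<Longrightarrow> h < d2 \<Longrightarrow> g t0 < g (t0 - h)"
    using DERIV_neg_dec_left[OF dg] \<open>\<delta> > 0\<close> by auto
  have g0: "g t0 = 0" and r0: "r t0 = 0" by (simp_all add: g_def r_def)
  define e where "e = min d (min d1 d2)"
  have "r t \<le> 0" if t: "\<bar>t - t0\<bar> < e" for t
  proof (cases t t0 rule: linorder_cases)
    case less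
    have "\<exists>z>t. z < t0 \<and> r t0 - r t = (t0 - t) * g z"
      by (rule MVT2[OF less]) (use t in \<open>auto intro!: dr simp: e_def\<close>)
    then obtain z where z: "t < z" "z < t0" "r t0 - r t = (t0 - t) * g z" by blast
    have "g z > 0" using d2(2)[of "t0 - z"] z t g0 by (auto simp: e_def)
    then have "(t0 - t) * g z > 0" using less by simp
    then show ?thesis using z r0 by simp
  next
    case equal
    then show ?thesis using r0 by simp
  next
    case greater
    have "\<exists>z>t0. z < t \<and> r t - r t0 = (t - t0) * g z"
      by (rule MVT2[OF greater]) (use t in \<open>auto intro!: dr simp: e_def\<close>)
    then obtain z where z: "t0 < z" "z < t" "r t - r t0 = (t - t0) * g z" by blast
    have "g z < 0" using d1(2)[of "z - t0"] z t g0 by (auto simp: e_def)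
    then have "(t - t0) * g z < 0" using greater by (simp add: mult_pos_neg)
    then show ?thesis using z r0 by simp
  qed
  then show ?thesis
    using that[of e] assms(1) d1(1) d2(1) by (auto simp: e_def r_def)
qed

text \<open>The value of the right-hand side of the equation at \<open>x\<close>.\<close>

definition source :: "nat \<Rightarrow> real \<Rightarrow> real \<Rightarrow> ((nat \<Rightarrow> real) \<Rightarrow> real) \<Rightarrow> ((nat \<Rightarrow> real) \<Rightarrow> real)
    \<Rightarrow> (nat \<Rightarrow> real) \<Rightarrow> real" where
  "source n \<alpha> m h u x = rn_norm n x powr \<alpha> * max (u x) 0 powr m + h x"

text \<open>
  A subsolution may be tested with \<open>q(|x - y|\<^sup>2)\<close> for any \<open>q\<close> that is twice differentiable at the relevant
  argument, even if \<open>q(|x - y|\<^sup>2)\<close> is not \<open>C\<^sup>2\<close> on the whole unit ball: near the touching point, \<open>q\<close> is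
  dominated by its second Taylor polynomial with second derivative increased by \<open>\<delta>\<close>, and \<open>\<delta>\<close> tends
  to \<open>0\<close>.
\<close>

lemma subsolution_radial_test:
  assumes sub: "viscosity_subsolution n \<alpha> m h u"
    and x0: "x0 \<in> rn_ball n origin 1"
    and "d > 0" "\<And>t. \<bar>t - (rn_dist n x0 y)\<^sup>2\<bar> < d \<Longrightarrow> (q has_real_derivative q' t) (at t)"
    and "(q' has_real_derivative q2) (at ((rn_dist n x0 y)\<^sup>2))"
    and "e > 0" "\<And>x. x \<in> rn_ball n x0 e \<inter> rn_ball n origin 1 \<Longrightarrow>
        u x - q ((rn_dist n x y)\<^sup>2) \<le> u x0 - q ((rn_dist n x0 y)\<^sup>2)"
  shows "source n \<alpha> m h u x0 \<le> 8 * (rn_dist n x0 y)\<^sup>2 * q' ((rn_dist n x0 y)\<^sup>2) ^ 3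
      + 16 * ((rn_dist n x0 y)\<^sup>2)\<^sup>2 * (q' ((rn_dist n x0 y)\<^sup>2))\<^sup>2 * q2"
proof (rule field_le_epsilon)
  define t0 where "t0 = (rn_dist n x0 y)\<^sup>2"
  define M where "M = 16 * t0\<^sup>2 * (q' t0)\<^sup>2"
  fix \<epsilon> :: real assume "\<epsilon> > 0"
  define \<delta> where "\<delta> = \<epsilon> / (M + 1)"
  have M: "M \<ge> 0" by (simp add: M_def)
  have \<delta>: "\<delta> > 0" "M * \<delta> \<le> \<epsilon>"
    using M \<open>\<epsilon> > 0\<close> by (simp_all add: \<delta>_def field_simps)
  obtain e1 where e1: "e1 > 0" and
    up: "\<And>t. \<bar>t - t0\<bar> < e1 \<Longrightarrow> q t \<le> q t0 + q' t0 * (t - t0) + (q2 + \<delta>) / 2 * (t - t0)\<^sup>2"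
    using quadratic_upper_bound_at[OF assms(3,4,5) \<delta>(1)] unfolding t0_def by blast
  have "isCont (\<lambda>s::real. s\<^sup>2) (rn_dist n x0 y)" by (intro continuous_intros)
  then obtain e2 where e2: "e2 > 0"
    "\<And>s. \<bar>s - rn_dist n x0 y\<bar> < e2 \<Longrightarrow> \<bar>s\<^sup>2 - t0\<bar> < e1"
    unfolding continuous_at_eps_delta t0_def dist_real_def using e1 by metis
  define c where "c = (q2 + \<delta>) / 2"
  define b where "b = q' t0 - 2 * c * t0"
  define a where "a = q t0 - q' t0 * t0 + c * t0\<^sup>2"
  define \<phi> where "\<phi> = (\<lambda>x. a + b * (\<Sum>j<n. (x j - y j)\<^sup>2) + c * (\<Sum>j<n. (x j - y j)\<^sup>2)\<^sup>2)"
  have phi: "\<phi> x = q t0 + q' t0 * ((rn_dist n x y)\<^sup>2 - t0) + c * ((rn_dist n x y)\<^sup>2 - t0)\<^sup>2" for x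
    unfolding \<phi>_def rn_dist_sq[symmetric] a_def b_def
    by (simp add: algebra_simps power2_eq_square)
  have "u x - \<phi> x \<le> u x0 - \<phi> x0" if x: "x \<in> rn_ball n x0 (min e e2) \<inter> rn_ball n origin 1" for x
  proof -
    have "\<bar>rn_dist n x y - rn_dist n x0 y\<bar> < e2"
      using rn_dist_triangle[of n x y x0] rn_dist_triangle[of n x0 y x] rn_dist_commute[of n x x0] x
      by (auto simp: rn_ball_def)
    then have "q ((rn_dist n x y)\<^sup>2) \<le> \<phi> x"
      using up[of "(rn_dist n x y)\<^sup>2"] e2(2) unfolding phi c_def by blast
    moreover have "\<phi> x0 = q t0" by (simp add: phi t0_def)
    moreover have "u x - q ((rn_dist n x y)\<^sup>2) \<le> u x0 - q t0"
      unfolding t0_def by (rule assms(7)) (use x in \<open>auto simp: rn_ball_def\<close>)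
    ultimately show ?thesis by linarith
  qed
  then have "local_max_at n (rn_ball n origin 1) (\<lambda>x. u x - \<phi> x) x0"
    using x0 \<open>e > 0\<close> e2(1) unfolding local_max_at_def by (intro conjI exI[of _ "min e e2"]) auto
  moreover have "Ck_on n (rn_ball n origin 1) 2 \<phi>"
    unfolding \<phi>_def by (rule Ck_on_quadratic_in_sq)
  ultimately have "source n \<alpha> m h u x0 \<le> inf_laplacian n \<phi> x0"
    using sub unfolding viscosity_subsolution_def source_def by blast
  also have "\<dots> = 8 * t0 * (q' t0) ^ 3 + 16 * t0\<^sup>2 * (q' t0)\<^sup>2 * (q2 + \<delta>)"
    unfolding \<phi>_def inf_laplacian_quadratic_in_sq t0_def[symmetric] by (simp add: b_def c_def)
  also have "\<dots> \<le> 8 * t0 * (q' t0) ^ 3 + 16 * t0\<^sup>2 * (q' t0)\<^sup>2 * q2 + \<epsilon>"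
    using \<delta>(2) unfolding M_def by (simp add: algebra_simps)
  finally show "source n \<alpha> m h u x0 \<le> 8 * (rn_dist n x0 y)\<^sup>2 * q' ((rn_dist n x0 y)\<^sup>2) ^ 3
      + 16 * ((rn_dist n x0 y)\<^sup>2)\<^sup>2 * (q' ((rn_dist n x0 y)\<^sup>2))\<^sup>2 * q2 + \<epsilon>"
    unfolding t0_def .
qed

lemma powr_half_power2: "x \<ge> 0 \<Longrightarrow> (x\<^sup>2) powr (p / 2) = x powr p" for x p :: real
  by (cases "x = 0") (simp_all add: powr_powr flip: powr_numeral)

lemma powr_3_mult_minus_4:
  fixes x p :: real
  assumes "x > 0"
  shows "x powr (3 * p - 4) = (x powr p) ^ 3 / x ^ 4"
proof -
  have "x powr (3 * p - 4) = x powr (3 * p) / x powr 4" by (rule powr_diff)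
  also have "x powr (3 * p) = (x powr p) powr 3" by (simp add: powr_powr mult.commute)
  also have "\<dots> = (x powr p) ^ 3" using assms by simp
  finally show ?thesis using assms by simp
qed

text \<open>Away from \<open>y\<close>, the infinity Laplacian of \<open>c |x - y| powr p\<close> is
  \<open>c\<^sup>3 p\<^sup>3 (p - 1) |x - y| powr (3 p - 4)\<close>.\<close>

lemma subsolution_power_test:
  assumes sub: "viscosity_subsolution n \<alpha> m h u"
    and x0: "x0 \<in> rn_ball n origin 1" and pos: "rn_dist n x0 y > 0"
    and "e > 0" "\<And>x. x \<in> rn_ball n x0 e \<inter> rn_ball n origin 1 \<Longrightarrow>
        u x - c * rn_dist n x y powr p \<le> u x0 - c * rn_dist n x0 y powr p"
  shows "source n \<alpha> m h u x0 \<le> c ^ 3 * p ^ 3 * (p - 1) * rn_dist n x0 y powr (3 * p - 4)"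
proof -
  define D where "D = rn_dist n x0 y"
  define b where "b = p / 2"
  define q where "q t = c * t powr b" for t :: real
  define q' where "q' t = c * b * t powr (b - 1)" for t :: real
  define q2 where "q2 = c * b * (b - 1) * (D\<^sup>2) powr (b - 2)"
  have D: "D > 0" using pos by (simp add: D_def)
  have dq: "(q has_real_derivative q' t) (at t)" if "\<bar>t - D\<^sup>2\<bar> < D\<^sup>2" for t
    unfolding q_def q'_def using that
    by (auto intro!: derivative_eq_intros)
  have dq': "(q' has_real_derivative q2) (at (D\<^sup>2))"
    unfolding q'_def q2_def using D
    by (auto intro!: derivative_eq_intros)
  have q: "q ((rn_dist n x y)\<^sup>2) = c * rn_dist n x y powr p" for x
    by (simp add: q_def b_def powr_half_power2)
  have qD: "q (D\<^sup>2) = c * D powr p" using q[of x0] by (simp add: D_def)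
  have "source n \<alpha> m h u x0 \<le> 8 * D\<^sup>2 * (q' (D\<^sup>2)) ^ 3 + 16 * (D\<^sup>2)\<^sup>2 * (q' (D\<^sup>2))\<^sup>2 * q2"
    unfolding D_def
    by (rule subsolution_radial_test[OF sub x0, where d = "D\<^sup>2" and e = e and q = q])
       (use D dq dq' assms(4,5) in \<open>auto simp: q qD simp flip: D_def\<close>)
  also have "\<dots> = c ^ 3 * p ^ 3 * (p - 1) * D powr (3 * p - 4)"
  proof -
    have e1: "(D\<^sup>2) powr s = D powr (2 * s)" for s
      using powr_half_power2[of D "2 * s"] D by simp
    have P1: "D powr (2 * (b - 1)) = D powr p / D\<^sup>2"
      using D by (simp add: b_def powr_diff right_diff_distrib)
    have P2: "D powr (2 * (b - 2)) = D powr p / D ^ 4"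
      using D powr_diff[of D p 4] by (simp add: b_def right_diff_distrib)
    have P3: "D powr (3 * p - 4) = (D powr p) ^ 3 / D ^ 4"
      using D by (rule powr_3_mult_minus_4)
    have p: "p = 2 * b" by (simp add: b_def)
    define P where "P = D powr p"
    show ?thesis
      unfolding q'_def q2_def e1 P1 P2 P3 P_def[symmetric] unfolding p using D
      by (simp add: field_simps power2_eq_square power3_eq_cube power4_eq_xxxx)
  qed
  finally show ?thesis by (simp add: D_def)
qed

section \<open>Comparison with powers of the distance\<close>

lemma rn_ball_subset_rn_cball:
  "rn_ball n z (r - rn_dist n z y) \<subseteq> rn_cball n y r"
proof
  fix x assume "x \<in> rn_ball n z (r - rn_dist n z y)"
  then show "x \<in> rn_cball n y r"
    using rn_dist_triangle[of n x y z] by (auto simp: rn_ball_def rn_cball_def)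
qed

text \<open>An interior maximum point other than the centre is a point where the power of the distance
  touches \<open>u\<close> from above, up to a constant.\<close>

lemma subsolution_max_on_cball:
  assumes sub: "viscosity_subsolution n \<alpha> m h u" and K: "rn_cball n y \<rho> \<subseteq> rn_ball n origin 1"
    and y: "y \<in> topspace (Euclidean_space n)" and "\<rho> > 0" "p > 0"
  obtains z where "z \<in> rn_cball n y \<rho>"
    "\<And>x. x \<in> rn_cball n y \<rho> \<Longrightarrow> u x - c * rn_dist n x y powr p \<le> u z - c * rn_dist n z y powr p"
    "rn_dist n z y = \<rho> \<or> z = y \<or>
       source n \<alpha> m h u z \<le> c ^ 3 * p ^ 3 * (p - 1) * rn_dist n z y powr (3 * p - 4)"
proof -
  let ?K = "rn_cball n y \<rho>"
  have ucont: "rn_cont n (rn_ball n origin 1) u"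
    using sub by (simp add: viscosity_subsolution_def)
  have yK: "y \<in> ?K" using y \<open>\<rho> > 0\<close> by (simp add: rn_cball_def)
  have c2: "continuous_on ?K (\<lambda>x. c * rn_dist n x y powr p)"
    using \<open>p > 0\<close> by (intro continuous_on_mult continuous_on_powr' continuous_on_const continuous_on_rn_dist) auto
  obtain z where z: "z \<in> ?K"
    and zmax: "\<And>x. x \<in> ?K \<Longrightarrow> u x - c * rn_dist n x y powr p \<le> u z - c * rn_dist n z y powr p"
    by (rule rn_cont_attains_sup[OF ucont K _ compact_rn_cball _ c2])
       (use yK in \<open>auto simp: rn_cball_def\<close>)
  have "source n \<alpha> m h u z \<le> c ^ 3 * p ^ 3 * (p - 1) * rn_dist n z y powr (3 * p - 4)"
    if "rn_dist n z y \<noteq> \<rho>" "z \<noteq> y"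
  proof (rule subsolution_power_test[OF sub])
    show "z \<in> rn_ball n origin 1" using z K by blast
    show "0 < rn_dist n z y"
      using rn_dist_eq_0[OF _ y, of z] z that(2) rn_dist_nonneg[of n z y]
      by (auto simp: rn_cball_def less_le)
    show "0 < \<rho> - rn_dist n z y" using z that(1) by (auto simp: rn_cball_def)
    fix x assume "x \<in> rn_ball n z (\<rho> - rn_dist n z y) \<inter> rn_ball n origin 1"
    then show "u x - c * rn_dist n x y powr p \<le> u z - c * rn_dist n z y powr p"
      using zmax rn_ball_subset_rn_cball by blast
  qed
  then show ?thesis using that[OF z zmax] by blast
qed

text \<open>
  Where the source is positive, \<open>u\<close> cannot lie below \<open>u x0 + a |x - x0| powr p\<close> with \<open>p > 4 / 3\<close>, a
  function that is not \<open>C\<^sup>2\<close> at \<open>x0\<close> if \<open>p < 2\<close>.  On the ball of radius \<open>\<delta>\<close> it is replaced by a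
  paraboloid, whose infinity Laplacian is of order \<open>\<delta> powr (3 p - 4)\<close> and so tends to \<open>0\<close> with \<open>\<delta>\<close>.
\<close>

lemma subsolution_no_power_peak:
  assumes sub: "viscosity_subsolution n \<alpha> m h u" and h: "rn_cont n (rn_ball n origin 1) h"
    and x0: "x0 \<in> rn_ball n origin 1" and "\<alpha> > 0" "m > 0" "a > 0" "p > 4 / 3" "R > 0"
    and F0: "source n \<alpha> m h u x0 > 0"
    and le: "\<And>x. x \<in> rn_ball n x0 R \<inter> rn_ball n origin 1 \<Longrightarrow> u x \<le> u x0 + a * rn_dist n x x0 powr p"
  shows False
proof -
  let ?B = "rn_ball n origin 1"
  let ?F = "source n \<alpha> m h u"
  have ucont: "rn_cont n ?B u" using sub by (simp add: viscosity_subsolution_def)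
  define \<kappa> where "\<kappa> = ?F x0 / 2"
  have "continuous_on (topspace (Euclidean_space n) \<inter> ?B) (\<lambda>x. rn_norm n x)"
    using continuous_on_rn_dist[of _ n origin] by simp
  then have "continuous_on (topspace (Euclidean_space n) \<inter> ?B) ?F"
    unfolding source_def using ucont h \<open>\<alpha> > 0\<close> \<open>m > 0\<close> unfolding rn_cont_iff_continuous_on
   
    by (intro continuous_on_add continuous_on_mult continuous_on_powr' continuous_on_max continuous_on_const) auto
  then have "openin (Euclidean_space n) {x \<in> ?B. ?F x > \<kappa>}"
    by (intro rn_cont_greater_openin openin_rn_ball) (simp add: rn_cont_iff_continuous_on)
  moreover have "x0 \<in> {x \<in> ?B. ?F x > \<kappa>}" using F0 x0 by (simp add: \<kappa>_def)
  ultimately obtain e where e: "e > 0" "rn_ball n x0 e \<subseteq> {x \<in> ?B. ?F x > \<kappa>}"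
    using openin_contains_rn_ball by blast
  have "((\<lambda>\<delta>. 64 * a ^ 3 * \<delta> powr (3 * p - 4)) \<longlongrightarrow> 64 * a ^ 3 * 0 powr (3 * p - 4)) (at_right 0)"
    using \<open>p > 4 / 3\<close> by (intro tendsto_intros) (auto simp: eventually_at_right_field intro!: exI[of _ 1])
  then have "\<forall>\<^sub>F \<delta> in at_right 0. 64 * a ^ 3 * \<delta> powr (3 * p - 4) < \<kappa>"
    by (rule order_tendstoD(2)) (use F0 \<open>p > 4 / 3\<close> in \<open>auto simp: \<kappa>_def\<close>)
  moreover have "\<forall>\<^sub>F \<delta> in at_right 0. \<delta> \<in> {0<..<min e R}"
    using \<open>R > 0\<close> e(1) by (intro eventually_at_right_real) auto
  ultimately have "\<forall>\<^sub>F \<delta> in at_right (0::real). \<delta> \<in> {0<..<min e R} \<and> 64 * a ^ 3 * \<delta> powr (3 * p - 4) < \<kappa>"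
    by eventually_elim simp
  then obtain \<delta> where \<delta>: "\<delta> > 0" "\<delta> < e" "\<delta> < R" "64 * a ^ 3 * \<delta> powr (3 * p - 4) < \<kappa>"
    using eventually_happens[of _ "at_right (0::real)"] by (auto simp: trivial_limit_at_right_real)
  \<comment> \<open>The paraboloid is twice as high as the power at distance \<open>\<delta>\<close>, so the maximum is interior.\<close>
  define A where "A = 2 * a * \<delta> powr (p - 2)"
  have A: "A > 0" using \<delta> \<open>a > 0\<close> by (simp add: A_def)
  have A\<delta>: "A * \<delta>\<^sup>2 = 2 * a * \<delta> powr p"
    using \<delta> powr_diff[of \<delta> p 2] by (simp add: A_def)
  have K: "rn_cball n x0 \<delta> \<subseteq> rn_ball n x0 e" "rn_cball n x0 \<delta> \<subseteq> rn_ball n x0 R"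
    using \<delta> by (auto simp: rn_cball_def rn_ball_def)
  have x0K: "x0 \<in> rn_cball n x0 \<delta>" using x0 \<delta> by (simp add: rn_cball_def rn_ball_def)
  have c2: "continuous_on (rn_cball n x0 \<delta>) (\<lambda>x. A * (rn_dist n x x0)\<^sup>2)"
    by (intro continuous_on_mult continuous_on_power continuous_on_const continuous_on_rn_dist)
  obtain z where z: "z \<in> rn_cball n x0 \<delta>" and
    zmax: "\<And>x. x \<in> rn_cball n x0 \<delta> \<Longrightarrow> u x - A * (rn_dist n x x0)\<^sup>2 \<le> u z - A * (rn_dist n z x0)\<^sup>2"
    by (rule rn_cont_attains_sup[OF ucont _ _ compact_rn_cball _ c2])
       (use K e x0K in \<open>auto simp: rn_cball_def\<close>)
  have zB: "z \<in> ?B" "?F z > \<kappa>" using z K e by blast+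
  have zd: "rn_dist n z x0 < \<delta>"
  proof (rule ccontr)
    assume "\<not> rn_dist n z x0 < \<delta>"
    then have D: "rn_dist n z x0 = \<delta>" using z by (auto simp: rn_cball_def)
    have "u z \<le> u x0 + a * \<delta> powr p" using le[of z] z K zB D by auto
    moreover have "u x0 \<le> u z - A * \<delta>\<^sup>2" using zmax[OF x0K] D by simp
    moreover have "a * \<delta> powr p > 0" using \<delta> \<open>a > 0\<close> by simp
    ultimately show False unfolding A\<delta> by linarith
  qed
  have "?F z \<le> 8 * (rn_dist n z x0)\<^sup>2 * A ^ 3 + 16 * ((rn_dist n z x0)\<^sup>2)\<^sup>2 * A\<^sup>2 * 0"
  proof (rule subsolution_radial_test[OF sub zB(1), where d = 1 and q = "\<lambda>t. A * t"
        and q' = "\<lambda>_. A" and e = "\<delta> - rn_dist n z x0"])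
    fix x assume "x \<in> rn_ball n z (\<delta> - rn_dist n z x0) \<inter> rn_ball n origin 1"
    then show "u x - A * (rn_dist n x x0)\<^sup>2 \<le> u z - A * (rn_dist n z x0)\<^sup>2"
      using zmax rn_ball_subset_rn_cball by blast
  qed (use zd in \<open>auto intro!: derivative_eq_intros\<close>)
  also have "\<dots> \<le> 8 * \<delta>\<^sup>2 * A ^ 3"
    using zd A by (simp add: power_mono)
  also have "\<dots> = 64 * a ^ 3 * \<delta> powr (3 * p - 4)"
  proof -
    have P3: "\<delta> powr (3 * p - 4) = (\<delta> powr p) ^ 3 / \<delta> ^ 4"
      using \<delta>(1) by (rule powr_3_mult_minus_4)
    have P2: "\<delta> powr (p - 2) = \<delta> powr p / \<delta>\<^sup>2"
      using \<delta> powr_diff[of \<delta> p 2] by simp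
    show ?thesis unfolding A_def P3 P2 using \<delta>
      by (simp add: field_simps power2_eq_square power3_eq_cube power4_eq_xxxx)
  qed
  finally show False using \<delta>(4) zB(2) by linarith
qed

text \<open>
  With \<open>p = 4 / (3 - m)\<close> one has \<open>p\<^sup>3 (p - 1) = 64 (1 + m) / (3 - m)\<^sup>4\<close> and \<open>3 p - 4 = m p\<close>, and
  \<open>|x| \<ge> (1 - \<theta>) |x0|\<close> on the ball; this is what the lower bound on \<open>h\<close> is tailored to.
\<close>

lemma subsolution_exceeds_barrier_on_sphere:
  fixes \<alpha> m \<theta> s :: real
  assumes sub: "viscosity_subsolution n \<alpha> m h u" and h: "rn_cont n (rn_ball n origin 1) h"
    and "\<alpha> > 0" "0 < m" "m < 3" "0 < \<theta>" "\<theta> < 1" "s > 0"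
    and x0: "x0 \<in> rn_ball n origin 1" "x0 \<noteq> origin" "u x0 > 0" "h x0 = 0"
    and \<rho>: "\<rho> > 0" "\<rho> < \<theta> * rn_norm n x0" "rn_cball n x0 \<rho> \<subseteq> rn_ball n origin 1"
    and hb: "\<And>x. x \<in> rn_cball n x0 \<rho> \<Longrightarrow>
       h x \<ge> - (s powr m) * ((1 - \<theta>) powr \<alpha> - 64 * (1 + m) / (3 - m) ^ 4 * s powr (3 - m)) *
         rn_norm n x0 powr (3 * \<alpha> / (3 - m)) * rn_dist n x x0 powr (4 * m / (3 - m))"
  obtains z where "z \<in> rn_cball n x0 \<rho>" "rn_dist n z x0 = \<rho>"
    "u z > s * rn_norm n x0 powr (\<alpha> / (3 - m)) * \<rho> powr (4 / (3 - m))"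
proof -
  define N where "N = rn_norm n x0"
  define p where "p = 4 / (3 - m)"
  define a where "a = s * N powr (\<alpha> / (3 - m))"
  have x0s: "x0 \<in> topspace (Euclidean_space n)" using x0 by (simp add: rn_ball_def)
  have N: "N > 0" using rn_norm_pos[OF x0s x0(2)] by (simp add: N_def)
  have p: "p > 4 / 3" using \<open>0 < m\<close> \<open>m < 3\<close> by (simp add: p_def field_simps)
  then have p0: "p > 0" by simp
  have a: "a > 0" using \<open>s > 0\<close> N by (simp add: a_def)
  have pK: "p ^ 3 * (p - 1) = 64 * (1 + m) / (3 - m) ^ 4"
  proof -
    have "p - 1 = (1 + m) / (3 - m)" using \<open>m < 3\<close> by (simp add: p_def field_simps)
    then show ?thesis by (simp add: p_def power_divide power3_eq_cube power4_eq_xxxx)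
  qed
  have pe: "3 * p - 4 = 4 * m / (3 - m)" "p * m = 4 * m / (3 - m)"
    using \<open>m < 3\<close> by (simp_all add: p_def field_simps)
  obtain z where z: "z \<in> rn_cball n x0 \<rho>"
    and zmax: "\<And>x. x \<in> rn_cball n x0 \<rho> \<Longrightarrow>
        u x - a * rn_dist n x x0 powr p \<le> u z - a * rn_dist n z x0 powr p"
    and alt: "rn_dist n z x0 = \<rho> \<or> z = x0 \<or>
       source n \<alpha> m h u z \<le> a ^ 3 * p ^ 3 * (p - 1) * rn_dist n z x0 powr (3 * p - 4)"
    by (rule subsolution_max_on_cball[OF sub \<rho>(3) x0s \<rho>(1) p0, where c = a]) blast
  have x0K: "x0 \<in> rn_cball n x0 \<rho>" using x0s \<rho> by (simp add: rn_cball_def)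
  have uz: "u z > a * rn_dist n z x0 powr p"
    using zmax[OF x0K] x0(3) p by simp
  have "rn_dist n z x0 = \<rho>"
  proof (rule ccontr)
    assume n1: "rn_dist n z x0 \<noteq> \<rho>"
    show False
    proof (cases "z = x0")
      case True
      have "u x \<le> u x0 + a * rn_dist n x x0 powr p" if "x \<in> rn_ball n x0 \<rho> \<inter> rn_ball n origin 1" for x
        using zmax[of x] that True p by (auto simp: rn_ball_def rn_cball_def)
      moreover have "source n \<alpha> m h u x0 > 0"
        using x0 N by (simp add: source_def N_def)
      ultimately show False
        using subsolution_no_power_peak[OF sub h x0(1) \<open>\<alpha> > 0\<close> \<open>0 < m\<close> a p \<rho>(1)] by blast
    next
      case False
      define D where "D = rn_dist n z x0"
      define M where "M = N powr (3 * \<alpha> / (3 - m))"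
      define T where "T = D powr (4 * m / (3 - m))"
      have D: "D > 0"
        using rn_dist_eq_0[OF _ x0s, of z] z False rn_dist_nonneg[of n z x0]
        by (auto simp: rn_cball_def D_def less_le)
      have "source n \<alpha> m h u z \<le> a ^ 3 * p ^ 3 * (p - 1) * T"
        using alt n1 False unfolding pe(1) T_def D_def by blast
      also have "\<dots> = a ^ 3 * (64 * (1 + m) / (3 - m) ^ 4) * T"
        unfolding pK[symmetric] by simp
      also have "a ^ 3 = s ^ 3 * M"
        using N by (simp add: a_def M_def power_mult_distrib powr_power)
      finally have up: "source n \<alpha> m h u z \<le> s ^ 3 * M * (64 * (1 + m) / (3 - m) ^ 4) * T" .
      have nz: "rn_norm n z \<ge> (1 - \<theta>) * N"
        using rn_norm_triangle[of x0 n z] rn_dist_commute[of n x0 z] z \<rho>(2)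
        by (auto simp: N_def rn_cball_def algebra_simps)
      have "(1 - \<theta>) powr \<alpha> * N powr \<alpha> \<le> rn_norm n z powr \<alpha>"
        using powr_mono2[OF _ _ nz, of \<alpha>] \<open>\<alpha> > 0\<close> \<open>\<theta> < 1\<close> N by (simp add: powr_mult)
      moreover have "(a * D powr p) powr m < max (u z) 0 powr m"
        using uz a \<open>0 < m\<close> by (intro powr_less_mono2) (auto simp: D_def)
      moreover have "0 < (1 - \<theta>) powr \<alpha> * N powr \<alpha>" using \<open>\<theta> < 1\<close> N by simp
      ultimately have "(1 - \<theta>) powr \<alpha> * N powr \<alpha> * (a * D powr p) powr m
          < rn_norm n z powr \<alpha> * max (u z) 0 powr m"
        by (intro mult_le_less_imp_less) auto
      moreover have "(a * D powr p) powr m = s powr m * N powr (\<alpha> / (3 - m) * m) * T"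
        using \<open>s > 0\<close> by (simp add: a_def T_def powr_mult powr_powr pe(2))
      moreover have "N powr \<alpha> * N powr (\<alpha> / (3 - m) * m) = M"
      proof -
        have "\<alpha> + \<alpha> / (3 - m) * m = 3 * \<alpha> / (3 - m)" using \<open>m < 3\<close> by (simp add: field_simps)
        then show ?thesis by (simp add: M_def flip: powr_add)
      qed
      moreover have "(1 - \<theta>) powr \<alpha> * N powr \<alpha> * (s powr m * N powr (\<alpha> / (3 - m) * m) * T)
          = (1 - \<theta>) powr \<alpha> * s powr m * (N powr \<alpha> * N powr (\<alpha> / (3 - m) * m)) * T"
        by (simp only: mult_ac)
      ultimately have low: "(1 - \<theta>) powr \<alpha> * s powr m * M * T < rn_norm n z powr \<alpha> * max (u z) 0 powr m"
        by (simp only:)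
      have s3: "s powr m * s powr (3 - m) = s ^ 3"
        using \<open>s > 0\<close> by (simp flip: powr_add)
      have expand: "- S * (A - K * S') * M * T = - (A * S * M * T) + (S * S') * M * K * T" for S S' A K :: real
        by (simp add: algebra_simps)
      have "h z \<ge> - (s powr m) * ((1 - \<theta>) powr \<alpha> - 64 * (1 + m) / (3 - m) ^ 4 * s powr (3 - m)) * M * T"
        using hb[OF z] unfolding M_def T_def N_def D_def .
      also have "- (s powr m) * ((1 - \<theta>) powr \<alpha> - 64 * (1 + m) / (3 - m) ^ 4 * s powr (3 - m)) * M * T
          = - ((1 - \<theta>) powr \<alpha> * s powr m * M * T)
            + (s powr m * s powr (3 - m)) * M * (64 * (1 + m) / (3 - m) ^ 4) * T"
        by (rule expand)
      finally show False using low up unfolding s3 source_def by linarith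
    qed
  qed
  then show ?thesis using that[OF z] uz unfolding a_def p_def N_def by blast
qed

text \<open>The hypothesis on \<open>c\<close> makes \<open>c |x| powr \<beta>\<close> a supersolution away from the origin.\<close>

lemma subsolution_le_power_barrier:
  fixes \<alpha> m \<beta> c \<mu> :: real
  assumes sub: "viscosity_subsolution n \<alpha> m h u"
    and "m > 0" "\<beta> > 0" "c > 0" "u origin \<le> 0"
    and r: "0 < r" "r < R" "R < 1"
    and hb: "\<And>x. x \<in> rn_ball n origin R \<Longrightarrow> h x \<ge> - \<mu> * rn_norm n x powr (\<alpha> + m * \<beta>)"
    and \<beta>: "3 * \<beta> - 4 = \<alpha> + m * \<beta>"
    and c: "c ^ 3 * \<beta> ^ 3 * (\<beta> - 1) + \<mu> \<le> c powr m"
    and bd: "\<And>x. x \<in> rn_sphere n origin r \<Longrightarrow> u x \<le> c * r powr \<beta>"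
    and x: "x \<in> rn_cball n origin r"
  shows "u x \<le> c * rn_norm n x powr \<beta>"
proof (rule ccontr)
  assume nle: "\<not> ?thesis"
  have K: "rn_cball n origin r \<subseteq> rn_ball n origin 1" "rn_cball n origin r \<subseteq> rn_ball n origin R"
    using r by (auto simp: rn_cball_def rn_ball_def)
  obtain z where z: "z \<in> rn_cball n origin r"
    and zmax: "\<And>x. x \<in> rn_cball n origin r \<Longrightarrow>
        u x - c * rn_norm n x powr \<beta> \<le> u z - c * rn_norm n z powr \<beta>"
    and alt: "rn_norm n z = r \<or> z = origin \<or>
       source n \<alpha> m h u z \<le> c ^ 3 * \<beta> ^ 3 * (\<beta> - 1) * rn_norm n z powr (3 * \<beta> - 4)"
    using subsolution_max_on_cball[OF sub K(1) origin_in_space \<open>0 < r\<close> \<open>\<beta> > 0\<close>, of c] by auto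
  have uz: "u z > c * rn_norm n z powr \<beta>"
    using zmax[OF x] nle by linarith
  have n1: "rn_norm n z \<noteq> r"
    using bd[of z] uz z by (auto simp: rn_sphere_def rn_cball_def)
  have n2: "z \<noteq> origin"
    using uz \<open>u origin \<le> 0\<close> \<open>\<beta> > 0\<close> by (auto simp: L2_set_def)
  define D where "D = rn_norm n z"
  have D: "D > 0" using n2 z rn_norm_pos[of z n] by (auto simp: rn_cball_def D_def)
  have up: "source n \<alpha> m h u z \<le> c ^ 3 * \<beta> ^ 3 * (\<beta> - 1) * D powr (\<alpha> + m * \<beta>)"
    using alt n1 n2 unfolding \<beta> D_def by blast
  have "(c * D powr \<beta>) powr m < max (u z) 0 powr m"
    using uz \<open>c > 0\<close> \<open>0 < m\<close> by (intro powr_less_mono2) (auto simp: D_def)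
  then have "D powr \<alpha> * (c * D powr \<beta>) powr m < D powr \<alpha> * max (u z) 0 powr m"
    using D by simp
  moreover have "D powr \<alpha> * (c * D powr \<beta>) powr m = c powr m * D powr (\<alpha> + m * \<beta>)"
    using \<open>c > 0\<close> by (simp add: powr_mult powr_powr powr_add mult.commute)
  moreover have "h z \<ge> - \<mu> * D powr (\<alpha> + m * \<beta>)" using hb[of z] z K unfolding D_def by blast
  moreover have "(c ^ 3 * \<beta> ^ 3 * (\<beta> - 1) + \<mu>) * D powr (\<alpha> + m * \<beta>) \<le> c powr m * D powr (\<alpha> + m * \<beta>)"
    using c by (intro mult_right_mono) auto
  ultimately show False using up unfolding source_def D_def[symmetric]
    by (simp add: distrib_right)
qed

section \<open>The asymptotic ratio at the origin\<close>

lemma perturbed_power_derivatives: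
  fixes t t2 A B b :: real
  assumes "t > 0" "t2 > 0"
  defines "\<sigma> \<equiv> \<lambda>t. t / t2 - 1"
  shows "((\<lambda>t. t powr b * (A + B * (\<sigma> t)\<^sup>2)) has_real_derivative
      t powr (b - 1) * (b * (A + B * (\<sigma> t)\<^sup>2) + 2 * B * \<sigma> t * (t / t2))) (at t)" (is ?d1)
    and "((\<lambda>t. t powr (b - 1) * (b * (A + B * (\<sigma> t)\<^sup>2) + 2 * B * \<sigma> t * (t / t2))) has_real_derivative
      t powr (b - 2) * (b * (b - 1) * (A + B * (\<sigma> t)\<^sup>2) + 4 * b * B * \<sigma> t * (t / t2)
         + 2 * B * (t / t2)\<^sup>2)) (at t)" (is ?d2)
proof -
  define P where "P = t powr (b - 2)"
  have P: "t powr b = P * t\<^sup>2" "t powr (b - 1) = P * t"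
    using powr_add[of t "b - 2" 2] powr_add[of t "b - 2" 1] \<open>t > 0\<close> by (simp_all add: P_def)
  have P2: "t powr (b - 1 - 1) = P" by (simp add: P_def)
  have ds: "(\<sigma> has_real_derivative 1 / t2) (at s)" for s
    unfolding \<sigma>_def using \<open>t2 > 0\<close> by (auto intro!: derivative_eq_intros)
  have dp: "((\<lambda>t. t powr a) has_real_derivative a * t powr (a - 1)) (at t)" for a
    using has_real_derivative_powr[OF \<open>t > 0\<close>] .
  have dG: "((\<lambda>t. A + B * (\<sigma> t)\<^sup>2) has_real_derivative 2 * B * \<sigma> t / t2) (at t)"
    by (auto intro!: derivative_eq_intros ds)
  have dw: "((\<lambda>t. t / t2) has_real_derivative 1 / t2) (at t)"
    using \<open>t2 > 0\<close> by (auto intro!: derivative_eq_intros)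
  have dE: "((\<lambda>t. b * (A + B * (\<sigma> t)\<^sup>2) + 2 * B * \<sigma> t * (t / t2)) has_real_derivative
      b * (2 * B * \<sigma> t / t2) + (2 * B * (1 / t2) * (t / t2) + 1 / t2 * (2 * B * \<sigma> t))) (at t)"
    by (rule DERIV_add DERIV_mult DERIV_cmult dG dw ds)+
  show ?d1
    by (rule DERIV_cong[OF DERIV_mult[OF dp dG]])
       (simp add: P field_simps power2_eq_square)
  show ?d2
    by (rule DERIV_cong[OF DERIV_mult[OF dp dE]], unfold P P2)
       (use assms(1,2) in \<open>simp add: P_def[symmetric] field_simps power2_eq_square\<close>)
qed

text \<open>
  In terms of \<open>t = |x|\<^sup>2\<close> and \<open>t2 = |x2|\<^sup>2\<close>, the test function is
  \<open>t powr (\<beta> / 2) * (A + B (t / t2 - 1)\<^sup>2)\<close> with \<open>B = 9 * \<epsilon>\<close>, on the annulus \<open>t2 / 2 \<le> t \<le> 3 t2 / 2\<close>.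
  Here \<open>G\<close> is the value of \<open>u / |x| powr \<beta>\<close> at the touching point, and \<open>E1\<close>, \<open>E2\<close> are the
  contributions to the first and second derivative that come from the slowly varying factor.
\<close>

lemma subsolution_asymptotic_ratio_approx:
  fixes \<alpha> m \<beta> \<mu> L \<epsilon> :: real
  assumes sub: "viscosity_subsolution n \<alpha> m h u"
    and "\<beta> > 0" "0 < \<epsilon>" "\<epsilon> < L" "0 < R" "R \<le> 1"
    and hb: "\<And>x. x \<in> rn_ball n origin R \<Longrightarrow> h x \<ge> - \<mu> * rn_norm n x powr (\<alpha> + m * \<beta>)"
    and \<beta>: "3 * \<beta> - 4 = \<alpha> + m * \<beta>"
    and upper: "\<And>x. x \<in> rn_ball n origin R \<Longrightarrow> u x \<le> (L + \<epsilon>) * rn_norm n x powr \<beta>"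
    and x2: "x2 \<in> rn_ball n origin (R / 2)" "x2 \<noteq> origin" "u x2 > (L - \<epsilon>) * rn_norm n x2 powr \<beta>"
  obtains G E1 E2 where "\<bar>G - L\<bar> \<le> \<epsilon>" "\<bar>E1\<bar> \<le> (14 + 36 * \<beta>) * \<epsilon>" "\<bar>E2\<bar> \<le> (41 + 36 * \<beta>) * \<epsilon>"
    "G powr m - \<mu> \<le> 8 * (\<beta> / 2 * G + E1) ^ 3
        + 16 * (\<beta> / 2 * G + E1)\<^sup>2 * (\<beta> / 2 * (\<beta> / 2 - 1) * G + E2)"
proof -
  define b where "b = \<beta> / 2"
  define t where "t x = (rn_norm n x)\<^sup>2" for x :: "nat \<Rightarrow> real"
  define t2 where "t2 = t x2"
  define \<sigma> where "\<sigma> = (\<lambda>s. s / t2 - 1)"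
  define B where "B = 9 * \<epsilon>"
  have x2s: "x2 \<in> topspace (Euclidean_space n)" using x2 by (simp add: rn_ball_def)
  have N2: "rn_norm n x2 > 0" using rn_norm_pos[OF x2s x2(2)] .
  then have t2: "t2 > 0" by (simp add: t2_def t_def)
  have tp: "t x powr b = rn_norm n x powr \<beta>" for x
    by (simp add: t_def b_def powr_half_power2)
  have "(rn_norm n x2)\<^sup>2 < (R / 2)\<^sup>2" using x2 by (intro power_strict_mono) (auto simp: rn_ball_def)
  then have t2R: "t2 < R\<^sup>2 / 4" by (simp add: t2_def t_def power_divide)
  define K where "K = rn_cball n origin R \<inter> {x. t2 / 2 \<le> t x} \<inter> {x. t x \<le> 3 / 2 * t2}"
  define V where "V = topspace (Euclidean_space n) \<inter> ({x. t2 / 2 < t x} \<inter> {x. t x < 3 / 2 * t2})"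
  have ct: "continuous_on S t" for S
    unfolding t_def using continuous_on_rn_dist[of S n origin] by (intro continuous_on_power) simp
  have cK: "compact K"
    unfolding K_def by (intro compact_Int_closed compact_rn_cball closed_Collect_le ct continuous_on_const)
  have oV: "openin (Euclidean_space n) V"
    unfolding openin_Euclidean_space_iff V_def
    by (intro exI[of _ "{x. t2 / 2 < t x} \<inter> {x. t x < 3 / 2 * t2}"] conjI open_Int open_Collect_less ct
        continuous_on_const refl)
  have less_R: "rn_norm n x < R" if "t x \<le> 3 / 2 * t2" for x
    using that t2R t2 \<open>0 < R\<close> by (intro power2_less_imp_less[of _ R]) (auto simp: t_def)
  have VK: "V \<subseteq> K"
  proof
    fix x assume x: "x \<in> V"
    then have "t x \<le> 3 / 2 * t2" by (auto simp: V_def)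
    with less_R[OF this] x show "x \<in> K" by (auto simp: V_def K_def rn_cball_def)
  qed
  have KR: "K \<subseteq> rn_ball n origin R" using less_R by (auto simp: K_def rn_cball_def rn_ball_def)
  have KB: "K \<subseteq> rn_ball n origin 1" using KR \<open>R \<le> 1\<close> by (auto simp: rn_ball_def)
  have x2K: "x2 \<in> K" using x2s t2 VK by (auto simp: V_def t2_def)
  have Kpos: "t x > 0" if "x \<in> K" for x using that t2 by (auto simp: K_def)
  define f where "f x = u x / t x powr b - B * (\<sigma> (t x))\<^sup>2" for x
  have "continuous_on K u"
    by (rule rn_cont_imp_continuous_on[OF _ KB])
       (use sub in \<open>auto simp: viscosity_subsolution_def K_def rn_cball_def\<close>)
  then have "continuous_on K f"
    unfolding f_def \<sigma>_def using Kpos t2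
    by (intro continuous_on_diff continuous_on_divide continuous_on_mult continuous_on_power
        continuous_on_powr continuous_on_const ct) (force dest: Kpos)+
  then obtain z where z: "z \<in> K" and zmax: "\<And>x. x \<in> K \<Longrightarrow> f x \<le> f z"
    using continuous_attains_sup[OF cK] x2K by blast
  define A where "A = f z"
  define G where "G = A + B * (\<sigma> (t z))\<^sup>2"
  have tz: "t z > 0" using Kpos z by blast
  have G: "G = u z / t z powr b" by (simp add: G_def A_def f_def)
  have AL: "A > L - \<epsilon>"
  proof -
    have "f x2 = u x2 / t x2 powr b" using t2 by (simp add: f_def \<sigma>_def t2_def)
    moreover have "L - \<epsilon> < u x2 / t x2 powr b"
      using x2(3) t2 unfolding tp[symmetric] by (simp add: pos_less_divide_eq t2_def)
    ultimately show ?thesis using zmax[OF x2K] by (simp add: A_def)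
  qed
  have GU: "G \<le> L + \<epsilon>"
    using upper[of z] z KR tz unfolding G tp[symmetric] by (auto simp: pos_divide_le_eq)
  have B: "B > 0" using \<open>0 < \<epsilon>\<close> by (simp add: B_def)
  have AG: "A \<le> G" using B by (simp add: G_def)
  \<comment> \<open>At the two ends of the annulus the penalty \<open>B / 4 > 2 * \<epsilon>\<close> outweighs the oscillation
    of the ratio, so that the maximum is interior.\<close>
  have \<sigma>lt: "\<bar>\<sigma> (t z)\<bar> < 1 / 2"
  proof (rule ccontr)
    assume "\<not> \<bar>\<sigma> (t z)\<bar> < 1 / 2"
    then have "(1 / 2)\<^sup>2 \<le> \<bar>\<sigma> (t z)\<bar>\<^sup>2" by (intro power_mono) auto
    then have "B / 4 \<le> B * (\<sigma> (t z))\<^sup>2" using B by (simp add: power_divide)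
    then show False using AL GU \<open>0 < \<epsilon>\<close> unfolding G_def B_def by linarith
  qed
  define w where "w = t z / t2"
  have \<sigma>w: "\<sigma> (t z) = w - 1" by (simp add: \<sigma>_def w_def)
  have w: "1 / 2 < w" "w < 3 / 2" using \<sigma>lt unfolding \<sigma>w by linarith+
  have zV: "z \<in> V"
    using z w t2 unfolding V_def K_def rn_cball_def w_def by (auto simp: field_simps)
  obtain e where e: "e > 0" "rn_ball n z e \<subseteq> V"
    using openin_contains_rn_ball[OF oV zV] by blast
  define q where "q s = s powr b * (A + B * (\<sigma> s)\<^sup>2)" for s
  define q' where "q' s = s powr (b - 1) * (b * (A + B * (\<sigma> s)\<^sup>2) + 2 * B * \<sigma> s * (s / t2))" for s
  define E1 where "E1 = 2 * B * \<sigma> (t z) * w"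
  define E2 where "E2 = 4 * b * B * \<sigma> (t z) * w + 2 * B * w\<^sup>2"
  define q2 where "q2 = t z powr (b - 2) * (b * (b - 1) * G + E2)"
  have dq: "(q has_real_derivative q' s) (at s)" if "\<bar>s - t z\<bar> < t z" for s
  proof -
    have "s > 0" using that by linarith
    show ?thesis
      using perturbed_power_derivatives(1)[OF \<open>s > 0\<close> t2, of b A B] unfolding q_def q'_def \<sigma>_def .
  qed
  have dq2: "(q' has_real_derivative q2) (at (t z))"
    using perturbed_power_derivatives(2)[OF tz t2, of b A B]
    unfolding q'_def q2_def \<sigma>_def E2_def G_def w_def by (simp add: add.assoc)
  have qz: "q (t z) = u z"
    using G tz unfolding q_def G_def[symmetric] by simp
  have "source n \<alpha> m h u z \<le> 8 * (rn_dist n z origin)\<^sup>2 * q' ((rn_dist n z origin)\<^sup>2) ^ 3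
      + 16 * ((rn_dist n z origin)\<^sup>2)\<^sup>2 * (q' ((rn_dist n z origin)\<^sup>2))\<^sup>2 * q2"
  proof (rule subsolution_radial_test[OF sub, where d = "t z" and q = q and e = e])
    fix x assume "x \<in> rn_ball n z e \<inter> rn_ball n origin 1"
    then have xK: "x \<in> K" using e VK by blast
    have "u x / t x powr b \<le> A + B * (\<sigma> (t x))\<^sup>2"
      using zmax[OF xK] by (simp add: A_def f_def)
    then have "u x \<le> q (t x)"
      using Kpos[OF xK] by (simp add: q_def pos_divide_le_eq mult.commute)
    then show "u x - q ((rn_dist n x origin)\<^sup>2) \<le> u z - q ((rn_dist n z origin)\<^sup>2)"
      using qz by (simp add: t_def)
  qed (use z KB tz dq dq2 e in \<open>auto simp: t_def\<close>)
  then have test: "source n \<alpha> m h u z \<le> 8 * t z * q' (t z) ^ 3 + 16 * (t z)\<^sup>2 * (q' (t z))\<^sup>2 * q2"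
    by (simp add: t_def)
  define D where "D = rn_norm n z"
  have D: "D > 0" using tz unfolding t_def D_def by (simp add: less_le)
  define P where "P = D powr \<beta>"
  have tzD: "t z = D\<^sup>2" by (simp add: t_def D_def)
  have pw: "t z powr (b - 1) = P / D\<^sup>2" "t z powr (b - 2) = P / D ^ 4"
    using powr_diff[of "t z" b 1] powr_diff[of "t z" b 2] tz
    unfolding tp by (simp_all add: P_def D_def[symmetric] tzD)
  have rhs: "8 * t z * q' (t z) ^ 3 + 16 * (t z)\<^sup>2 * (q' (t z))\<^sup>2 * q2
      = D powr (\<alpha> + m * \<beta>) * (8 * (b * G + E1) ^ 3 + 16 * (b * G + E1)\<^sup>2 * (b * (b - 1) * G + E2))"
  proof -
    have q'z: "q' (t z) = P / D\<^sup>2 * (b * G + E1)"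
      unfolding q'_def pw E1_def w_def G_def by simp
    have scale: "8 * D\<^sup>2 * (P / D\<^sup>2 * X) ^ 3 + 16 * (D\<^sup>2)\<^sup>2 * (P / D\<^sup>2 * X)\<^sup>2 * (P / D ^ 4 * Y)
        = P ^ 3 / D ^ 4 * (8 * X ^ 3 + 16 * X\<^sup>2 * Y)" for X Y
      using D by (simp add: field_simps power2_eq_square power3_eq_cube power4_eq_xxxx)
    have "D powr (\<alpha> + m * \<beta>) = P ^ 3 / D ^ 4"
      unfolding \<beta>[symmetric] P_def by (rule powr_3_mult_minus_4[OF D])
    then show ?thesis
      unfolding q'z q2_def pw unfolding tzD by (simp only: scale)
  qed
  have uz: "u z = G * P" "G > 0"
    using G tz AL AG \<open>\<epsilon> < L\<close> by (auto simp: tp P_def D_def)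
  then have "max (u z) 0 powr m = G powr m * D powr (m * \<beta>)"
    using D by (simp add: P_def powr_mult powr_powr mult.commute)
  then have "source n \<alpha> m h u z = G powr m * D powr (\<alpha> + m * \<beta>) + h z"
    by (simp add: source_def powr_add D_def)
  moreover have "h z \<ge> - \<mu> * D powr (\<alpha> + m * \<beta>)"
    using hb[of z] z KR unfolding D_def by blast
  ultimately have "D powr (\<alpha> + m * \<beta>) * (G powr m - \<mu>) \<le> D powr (\<alpha> + m * \<beta>) *
      (8 * (b * G + E1) ^ 3 + 16 * (b * G + E1)\<^sup>2 * (b * (b - 1) * G + E2))"
    using test unfolding rhs by (simp add: algebra_simps)
  then have fin: "G powr m - \<mu> \<le> 8 * (b * G + E1) ^ 3 + 16 * (b * G + E1)\<^sup>2 * (b * (b - 1) * G + E2)"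
    using D by simp
  have sw: "\<bar>\<sigma> (t z) * w\<bar> \<le> 3 / 4"
  proof -
    have "\<bar>\<sigma> (t z)\<bar> * \<bar>w\<bar> \<le> 1 / 2 * (3 / 2)" using \<sigma>lt w by (intro mult_mono) auto
    then show ?thesis by (simp add: abs_mult)
  qed
  have w2: "w\<^sup>2 \<le> 9 / 4" using power_mono[of w "3 / 2" 2] w by (simp add: power_divide)
  have b: "b > 0" using \<open>\<beta> > 0\<close> by (simp add: b_def)
  have "\<bar>E1\<bar> = 18 * \<epsilon> * \<bar>\<sigma> (t z) * w\<bar>"
    using \<open>0 < \<epsilon>\<close> by (simp add: E1_def B_def abs_mult)
  also have "\<dots> \<le> 18 * \<epsilon> * (3 / 4)" using sw \<open>0 < \<epsilon>\<close> by (intro mult_left_mono) auto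
  also have "\<dots> \<le> (14 + 36 * \<beta>) * \<epsilon>" using \<open>0 < \<epsilon>\<close> \<open>\<beta> > 0\<close> by (simp add: distrib_right)
  finally have e1: "\<bar>E1\<bar> \<le> (14 + 36 * \<beta>) * \<epsilon>" .
  have "\<bar>E2\<bar> \<le> \<bar>36 * b * \<epsilon> * (\<sigma> (t z) * w)\<bar> + \<bar>18 * \<epsilon> * w\<^sup>2\<bar>"
    unfolding E2_def B_def by (rule order_trans[OF _ abs_triangle_ineq]) (simp add: mult_ac)
  also have "\<dots> = 36 * b * \<epsilon> * \<bar>\<sigma> (t z) * w\<bar> + 18 * \<epsilon> * w\<^sup>2"
    using \<open>0 < \<epsilon>\<close> b by (simp add: abs_mult)
  also have "\<dots> \<le> 36 * b * \<epsilon> * (3 / 4) + 18 * \<epsilon> * (9 / 4)"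
    using sw w2 \<open>0 < \<epsilon>\<close> b by (intro add_mono mult_left_mono) auto
  also have "\<dots> \<le> (41 + 36 * \<beta>) * \<epsilon>"
  proof -
    have "\<beta> * \<epsilon> > 0" using \<open>0 < \<epsilon>\<close> \<open>\<beta> > 0\<close> by simp
    then show ?thesis using \<open>0 < \<epsilon>\<close> by (simp add: algebra_simps b_def)
  qed
  finally have e2: "\<bar>E2\<bar> \<le> (41 + 36 * \<beta>) * \<epsilon>" .
  have "\<bar>G - L\<bar> \<le> \<epsilon>" using AL AG GU by linarith
  then show ?thesis using that e1 e2 fin unfolding b_def by blast
qed

text \<open>The limsup \<open>L\<close> of \<open>u / |x| powr \<beta>\<close> satisfies the inequality that \<open>u = L |x| powr \<beta>\<close> would satisfy if
  \<open>h\<close> equalled \<open>- \<mu> |x| powr (\<alpha> + m \<beta>)\<close>.\<close>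

lemma subsolution_asymptotic_ratio:
  fixes \<alpha> m \<beta> \<mu> L :: real
  assumes sub: "viscosity_subsolution n \<alpha> m h u"
    and "\<beta> > 0" "L > 0" "0 < R" "R \<le> 1"
    and hb: "\<And>x. x \<in> rn_ball n origin R \<Longrightarrow> h x \<ge> - \<mu> * rn_norm n x powr (\<alpha> + m * \<beta>)"
    and \<beta>: "3 * \<beta> - 4 = \<alpha> + m * \<beta>"
    and upper: "\<And>\<epsilon>. \<epsilon> > 0 \<Longrightarrow> \<exists>\<delta>>0. \<forall>x\<in>rn_ball n origin \<delta>. u x \<le> (L + \<epsilon>) * rn_norm n x powr \<beta>"
    and lower: "\<And>\<epsilon> \<delta>. \<epsilon> > 0 \<Longrightarrow> \<delta> > 0 \<Longrightarrow>
        \<exists>x\<in>rn_ball n origin \<delta>. x \<noteq> origin \<and> u x > (L - \<epsilon>) * rn_norm n x powr \<beta>"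
  shows "L powr m - \<mu> \<le> L ^ 3 * \<beta> ^ 3 * (\<beta> - 1)"
proof -
  define Q where "Q G E1 E2 = 8 * (\<beta> / 2 * G + E1) ^ 3
        + 16 * (\<beta> / 2 * G + E1)\<^sup>2 * (\<beta> / 2 * (\<beta> / 2 - 1) * G + E2)" for G E1 E2 :: real
  define \<epsilon> where "\<epsilon> k = L / 2 * inverse (real (Suc k))" for k
  have "\<exists>G E1 E2. \<bar>G - L\<bar> \<le> \<epsilon> k \<and> \<bar>E1\<bar> \<le> (14 + 36 * \<beta>) * \<epsilon> k \<and> \<bar>E2\<bar> \<le> (41 + 36 * \<beta>) * \<epsilon> k
      \<and> G powr m - \<mu> \<le> Q G E1 E2" for k
  proof -
    have \<epsilon>: "0 < \<epsilon> k" using \<open>L > 0\<close> by (simp add: \<epsilon>_def)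
    have "inverse (real (Suc k)) \<le> 1" by (simp add: field_simps)
    then have "\<epsilon> k \<le> L / 2 * 1" unfolding \<epsilon>_def using \<open>L > 0\<close> by (intro mult_left_mono) auto
    then have \<epsilon>L: "\<epsilon> k < L" using \<open>L > 0\<close> by linarith
    obtain \<delta> where \<delta>: "\<delta> > 0" "\<forall>x\<in>rn_ball n origin \<delta>. u x \<le> (L + \<epsilon> k) * rn_norm n x powr \<beta>"
      using upper[OF \<epsilon>] by blast
    define r where "r = min R \<delta>"
    have r: "0 < r" "r \<le> 1" using \<open>0 < R\<close> \<open>R \<le> 1\<close> \<delta> by (auto simp: r_def)
    obtain x2 where x2: "x2 \<in> rn_ball n origin (r / 2)" "x2 \<noteq> origin"
      "u x2 > (L - \<epsilon> k) * rn_norm n x2 powr \<beta>"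
      using lower[OF \<epsilon>, of "r / 2"] r by auto
    have 1: "h x \<ge> - \<mu> * rn_norm n x powr (\<alpha> + m * \<beta>)" if "x \<in> rn_ball n origin r" for x
      by (rule hb) (use that in \<open>auto simp: rn_ball_def r_def\<close>)
    have 2: "u x \<le> (L + \<epsilon> k) * rn_norm n x powr \<beta>" if "x \<in> rn_ball n origin r" for x
      by (rule \<delta>(2)[rule_format]) (use that in \<open>auto simp: rn_ball_def r_def\<close>)
    show ?thesis
      by (rule subsolution_asymptotic_ratio_approx[OF sub \<open>\<beta> > 0\<close> \<epsilon> \<epsilon>L r 1 \<beta> 2 x2])
         (auto simp: Q_def)
  qed
  then obtain G E1 E2 where w: "\<bar>G k - L\<bar> \<le> \<epsilon> k" "\<bar>E1 k\<bar> \<le> (14 + 36 * \<beta>) * \<epsilon> k"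
    "\<bar>E2 k\<bar> \<le> (41 + 36 * \<beta>) * \<epsilon> k" "G k powr m - \<mu> \<le> Q (G k) (E1 k) (E2 k)" for k
    by metis
  have \<epsilon>0: "\<epsilon> \<longlonglongrightarrow> 0"
    unfolding \<epsilon>_def by (rule tendsto_mult_right_zero[OF LIMSEQ_inverse_real_of_nat])
  have "(\<lambda>k. G k - L) \<longlonglongrightarrow> 0"
    by (rule Lim_null_comparison[OF _ \<epsilon>0]) (simp add: w)
  then have G: "G \<longlonglongrightarrow> L" by (simp add: LIM_zero_iff)
  have E1: "E1 \<longlonglongrightarrow> 0"
    by (rule Lim_null_comparison[OF _ tendsto_mult_right_zero[OF \<epsilon>0, of "14 + 36 * \<beta>"]]) (simp add: w(2))
  have E2: "E2 \<longlonglongrightarrow> 0"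
    by (rule Lim_null_comparison[OF _ tendsto_mult_right_zero[OF \<epsilon>0, of "41 + 36 * \<beta>"]]) (simp add: w(3))
  have "(\<lambda>k. G k powr m - \<mu>) \<longlonglongrightarrow> L powr m - \<mu>"
    using \<open>L > 0\<close> by (intro tendsto_intros G) auto
  moreover have "(\<lambda>k. Q (G k) (E1 k) (E2 k)) \<longlonglongrightarrow> Q L 0 0"
    unfolding Q_def by (intro tendsto_intros G E1 E2)
  ultimately have "L powr m - \<mu> \<le> Q L 0 0"
    using w(4) by (rule_tac LIMSEQ_le) auto
  also have "\<dots> = L ^ 3 * \<beta> ^ 3 * (\<beta> - 1)"
    by (simp add: Q_def field_simps power2_eq_square power3_eq_cube)
  finally show ?thesis .
qed

section \<open>Growth at the free boundary\<close>

text \<open>At the point found in lemma \<open>subsolution_exceeds_barrier_on_sphere\<close>, the factor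
  \<open>2 powr - \<beta>\<close> converts \<open>|x0| powr \<beta>\<close> into \<open>|z| powr \<beta>\<close>, as \<open>|z| < 2 |x0|\<close>.\<close>

lemma positive_near_origin:
  fixes \<alpha> m \<theta> s \<delta> :: real
  assumes sub: "viscosity_subsolution n \<alpha> m h u" and h: "rn_cont n (rn_ball n origin 1) h"
    and "\<alpha> > 0" "0 < m" "m < 3" "0 < \<theta>" "\<theta> < 1" "s > 0" and u0: "u origin \<le> 0"
    and cl: "origin \<in> Euclidean_space n closure_of (positivity_set n u \<inter> zero_set n h)"
    and hb: "\<And>x0 x. x0 \<in> positivity_set n u \<inter> zero_set n h \<Longrightarrow>
       x \<in> rn_ball n x0 (\<theta> * rn_norm n x0) \<inter> rn_ball n origin 1 \<Longrightarrow>
       h x \<ge> - (s powr m) * ((1 - \<theta>) powr \<alpha> - 64 * (1 + m) / (3 - m) ^ 4 * s powr (3 - m)) *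
         rn_norm n x0 powr (3 * \<alpha> / (3 - m)) * rn_dist n x x0 powr (4 * m / (3 - m))"
    and "\<delta> > 0"
  obtains z where "z \<in> rn_ball n origin \<delta>" "z \<in> rn_ball n origin 1" "z \<noteq> origin"
    "u z > s * (\<theta> / 2) powr (4 / (3 - m)) * 2 powr - ((4 + \<alpha>) / (3 - m))
       * rn_norm n z powr ((4 + \<alpha>) / (3 - m))"
proof -
  define \<delta>' where "\<delta>' = min \<delta> 1 / 2"
  have "\<delta>' > 0" using \<open>\<delta> > 0\<close> by (simp add: \<delta>'_def)
  then have "origin \<in> rn_ball n origin \<delta>'" by (simp add: rn_ball_def L2_set_def)
  then obtain x0 where x0: "x0 \<in> positivity_set n u \<inter> zero_set n h" "x0 \<in> rn_ball n origin \<delta>'"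
    using cl openin_rn_ball[of n origin \<delta>'] unfolding in_closure_of by blast
  have x0': "x0 \<in> rn_ball n origin 1" "u x0 > 0" "h x0 = 0"
    using x0 by (auto simp: positivity_set_def zero_set_def)
  have x0n: "x0 \<noteq> origin" using x0'(2) u0 by auto
  define N where "N = rn_norm n x0"
  have N: "N > 0" "N < \<delta>'"
    using rn_norm_pos[of x0 n] x0' x0n x0(2) by (auto simp: rn_ball_def N_def)
  \<comment> \<open>Any fixed fraction of \<open>\<theta> * N\<close> would do; one half keeps the closed ball inside the open
    ball on which \<open>h\<close> is controlled.\<close>
  define \<rho> where "\<rho> = \<theta> * N / 2"
  have \<rho>: "\<rho> > 0" "\<rho> < \<theta> * N" using N \<open>0 < \<theta>\<close> by (simp_all add: \<rho>_def)
  have \<rho>N: "\<rho> < N / 2" using N \<open>\<theta> < 1\<close> by (simp add: \<rho>_def)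
  have nrm: "rn_norm n x < 2 * N" if "x \<in> rn_cball n x0 \<rho>" for x
    using rn_norm_triangle[of x n x0] that \<rho>N N by (auto simp: rn_cball_def N_def)
  have sub1: "rn_cball n x0 \<rho> \<subseteq> rn_ball n origin 1"
    using nrm N by (force simp: \<delta>'_def rn_cball_def rn_ball_def)
  have sub2: "rn_cball n x0 \<rho> \<subseteq> rn_ball n x0 (\<theta> * rn_norm n x0)"
    using \<rho>(2) by (auto simp: rn_cball_def rn_ball_def N_def)
  have hb': "h x \<ge> - (s powr m) * ((1 - \<theta>) powr \<alpha> - 64 * (1 + m) / (3 - m) ^ 4 * s powr (3 - m)) *
         rn_norm n x0 powr (3 * \<alpha> / (3 - m)) * rn_dist n x x0 powr (4 * m / (3 - m))"
    if "x \<in> rn_cball n x0 \<rho>" for x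
    by (rule hb[OF x0(1)]) (use that sub1 sub2 in blast)
  obtain z where z: "z \<in> rn_cball n x0 \<rho>" "rn_dist n z x0 = \<rho>"
    "u z > s * N powr (\<alpha> / (3 - m)) * \<rho> powr (4 / (3 - m))"
    unfolding N_def
    by (rule subsolution_exceeds_barrier_on_sphere[OF sub h assms(3-8) x0'(1) x0n x0'(2,3) \<rho>(1) _ sub1 hb'])
       (use \<rho>(2) in \<open>simp_all add: N_def\<close>)
  have "rn_norm n z > 0"
    using rn_norm_triangle[of x0 n z] rn_dist_commute[of n x0 z] z(2) \<rho>N N(1) by (simp add: N_def)
  then have zn: "z \<noteq> origin" by (auto simp: L2_set_def)
  define \<beta> where "\<beta> = (4 + \<alpha>) / (3 - m)"
  have \<beta>: "\<beta> > 0" using \<open>\<alpha> > 0\<close> \<open>m < 3\<close> by (simp add: \<beta>_def)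
  have "s * (\<theta> / 2) powr (4 / (3 - m)) * 2 powr - \<beta> * rn_norm n z powr \<beta>
      \<le> s * (\<theta> / 2) powr (4 / (3 - m)) * 2 powr - \<beta> * (2 * N) powr \<beta>"
    using nrm[OF z(1)] \<beta> \<open>s > 0\<close> by (intro mult_left_mono powr_mono2) auto
  also have "\<dots> = s * (\<theta> / 2) powr (4 / (3 - m)) * N powr \<beta>"
    by (simp add: powr_mult powr_minus)
  also have "\<dots> = s * (\<theta> / 2) powr (4 / (3 - m)) * (N powr (\<alpha> / (3 - m)) * N powr (4 / (3 - m)))"
    by (simp add: \<beta>_def add_divide_distrib add.commute flip: powr_add)
  also have "\<dots> = s * N powr (\<alpha> / (3 - m)) * \<rho> powr (4 / (3 - m))"
  proof -
    have "\<rho> = \<theta> / 2 * N" by (simp add: \<rho>_def)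
    then have "\<rho> powr (4 / (3 - m)) = (\<theta> / 2) powr (4 / (3 - m)) * N powr (4 / (3 - m))"
      by (simp only: powr_mult)
    then show ?thesis by simp
  qed
  also note z(3)
  finally have "u z > s * (\<theta> / 2) powr (4 / (3 - m)) * 2 powr - \<beta> * rn_norm n z powr \<beta>" .
  moreover have "z \<in> rn_ball n origin \<delta>"
    using nrm[OF z(1)] z(1) N(2) by (auto simp: \<delta>'_def rn_ball_def rn_cball_def)
  ultimately show ?thesis using that z(1) sub1 zn unfolding \<beta>_def by blast
qed

lemma nonpos_at_frontier_of_positivity_set:
  assumes "rn_cont n (rn_ball n origin 1) u"
    and "x \<in> Euclidean_space n frontier_of positivity_set n u"
  shows "x \<in> rn_ball n origin 1 \<Longrightarrow> u x \<le> 0"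
proof (rule ccontr)
  assume "x \<in> rn_ball n origin 1" "\<not> u x \<le> 0"
  then have "x \<in> positivity_set n u" by (simp add: positivity_set_def)
  moreover have "openin (Euclidean_space n) (positivity_set n u)"
    unfolding positivity_set_def by (rule rn_cont_greater_openin[OF openin_rn_ball assms(1)])
  ultimately show False
    using assms(2) by (simp add: frontier_of_def interior_of_openin)
qed

text \<open>The main argument for one \<open>\<eta>\<close>: the hypothesis on \<open>\<mu>\<close> excludes every value \<open>l\<close> in \<open>[min \<kappa> c, c]\<close>
  of the limsup.\<close>

lemma subsolution_growth:
  fixes \<alpha> m \<beta> c \<kappa> \<mu> r R :: real
  assumes sub: "viscosity_subsolution n \<alpha> m h u" and u0: "u origin \<le> 0"
    and "m > 0" and \<beta>: "\<beta> > 1" "3 * \<beta> - 4 = \<alpha> + m * \<beta>"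
    and "c > 0" "\<kappa> > 0"
    and hb: "\<And>x. x \<in> rn_ball n origin R \<Longrightarrow> h x \<ge> - \<mu> * rn_norm n x powr (\<alpha> + m * \<beta>)"
    and \<mu>: "\<And>l. min \<kappa> c \<le> l \<Longrightarrow> l \<le> c \<Longrightarrow> l ^ 3 * \<beta> ^ 3 * (\<beta> - 1) + \<mu> < l powr m"
    and near: "\<And>\<delta>. \<delta> > 0 \<Longrightarrow> \<exists>x\<in>rn_ball n origin \<delta>. x \<noteq> origin \<and> u x > \<kappa> * rn_norm n x powr \<beta>"
    and r: "0 < r" "r < R" "R < 1"
  shows "(SUP x\<in>rn_sphere n origin r. u x) \<ge> c * r powr \<beta>"
proof (rule ccontr)
  assume n: "\<not> ?thesis"
  have sph: "rn_sphere n origin r \<subseteq> rn_cball n origin r" by (auto simp: rn_sphere_def rn_cball_def)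
  have cb: "rn_cball n origin r \<subseteq> rn_ball n origin 1" using r by (auto simp: rn_cball_def rn_ball_def)
  have "continuous_on (rn_cball n origin r) u"
    by (rule rn_cont_imp_continuous_on[OF _ cb])
       (use sub in \<open>auto simp: viscosity_subsolution_def rn_cball_def\<close>)
  then have "bounded (u ` rn_cball n origin r)"
    using compact_continuous_image compact_imp_bounded compact_rn_cball by blast
  then have bdd: "bdd_above (u ` rn_sphere n origin r)"
    by (rule_tac bdd_above_mono[OF bounded_imp_bdd_above]) (use sph in auto)
  have bd: "u x \<le> c * r powr \<beta>" if "x \<in> rn_sphere n origin r" for x
    using cSUP_upper[OF that bdd] n by linarith
  have \<beta>0: "\<beta> > 0" using \<beta> by simp
  have c: "c ^ 3 * \<beta> ^ 3 * (\<beta> - 1) + \<mu> \<le> c powr m" using \<mu>[of c] by simp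
  have bar: "u x \<le> c * rn_norm n x powr \<beta>" if "x \<in> rn_cball n origin r" for x
    by (rule subsolution_le_power_barrier[OF sub \<open>m > 0\<close> \<beta>0 \<open>c > 0\<close> u0 r hb \<beta>(2) c bd that])
  \<comment> \<open>The infimum of \<open>S\<close> is the limsup of \<open>u / |x| powr \<beta>\<close> at the origin.\<close>
  define S where "S = {l. \<exists>\<delta>>0. \<forall>x\<in>rn_ball n origin \<delta>. u x \<le> l * rn_norm n x powr \<beta>}"
  have cS: "c \<in> S"
    unfolding S_def using r(1) bar by (auto intro!: exI[of _ r] simp: rn_ball_def rn_cball_def)
  have lb: "\<kappa> \<le> l" if lS: "l \<in> S" for l
  proof -
    obtain \<delta> where \<delta>: "\<delta> > 0" "\<forall>x\<in>rn_ball n origin \<delta>. u x \<le> l * rn_norm n x powr \<beta>"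
      using lS by (auto simp: S_def)
    obtain x where x: "x \<in> rn_ball n origin \<delta>" "x \<noteq> origin" "u x > \<kappa> * rn_norm n x powr \<beta>"
      using near[OF \<delta>(1)] by blast
    have "\<kappa> * rn_norm n x powr \<beta> < l * rn_norm n x powr \<beta>" using x \<delta>(2) by force
    then show ?thesis
      by (rule_tac less_imp_le, rule_tac mult_right_less_imp_less) auto
  qed
  then have bb: "bdd_below S" by (meson bdd_belowI)
  define L where "L = Inf S"
  have L\<kappa>: "\<kappa> \<le> L" unfolding L_def using cS lb by (intro cInf_greatest) auto
  have Lc: "L \<le> c" unfolding L_def using cS bb by (rule cInf_lower)
  have L: "L > 0" using L\<kappa> \<open>\<kappa> > 0\<close> by linarith
  have "L powr m - \<mu> \<le> L ^ 3 * \<beta> ^ 3 * (\<beta> - 1)"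
  proof (rule subsolution_asymptotic_ratio[OF sub \<beta>0 L _ _ hb \<beta>(2)])
    fix \<epsilon> :: real assume "\<epsilon> > 0"
    then obtain l where l: "l \<in> S" "l < L + \<epsilon>"
      using cInf_lessD[of S "L + \<epsilon>"] cS by (auto simp: L_def)
    then obtain \<delta> where \<delta>: "\<delta> > 0" "\<forall>x\<in>rn_ball n origin \<delta>. u x \<le> l * rn_norm n x powr \<beta>"
      by (auto simp: S_def)
    have "u x \<le> (L + \<epsilon>) * rn_norm n x powr \<beta>" if "x \<in> rn_ball n origin \<delta>" for x
    proof -
      have "l * rn_norm n x powr \<beta> \<le> (L + \<epsilon>) * rn_norm n x powr \<beta>"
        using l by (intro mult_right_mono) auto
      then show ?thesis using \<delta>(2) that by force
    qed
    then show "\<exists>\<delta>>0. \<forall>x\<in>rn_ball n origin \<delta>. u x \<le> (L + \<epsilon>) * rn_norm n x powr \<beta>"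
      using \<delta>(1) by blast
  next
    fix \<epsilon> \<delta> :: real assume "\<epsilon> > 0" "\<delta> > 0"
    then have "L - \<epsilon> \<notin> S" using cInf_lower[OF _ bb, of "L - \<epsilon>"] by (auto simp: L_def)
    then obtain x where x: "x \<in> rn_ball n origin \<delta>" "u x > (L - \<epsilon>) * rn_norm n x powr \<beta>"
      using \<open>\<delta> > 0\<close> unfolding S_def by force
    moreover have "x \<noteq> origin" using x(2) u0 \<beta>0 by (auto simp: L2_set_def)
    ultimately show "\<exists>x\<in>rn_ball n origin \<delta>. x \<noteq> origin \<and> u x > (L - \<epsilon>) * rn_norm n x powr \<beta>"
      by blast
  qed (use r in auto)
  moreover have "L ^ 3 * \<beta> ^ 3 * (\<beta> - 1) + \<mu> < L powr m"
    using \<mu> L\<kappa> Lc by simp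
  ultimately show False by linarith
qed

theorem theorem1p4:
  fixes \<alpha> m \<theta> s :: real
  assumes "\<alpha> > 0" and "0 < m" and "m < 3" and "0 < \<theta>" and "\<theta> < 1" and "s > 0"
    and "s < ((3 - m) ^ 4 * (1 - \<theta>) powr \<alpha> / (64 * (1 + m))) powr (1 / (3 - m))"
  shows "\<exists>\<mu>0 :: real \<Rightarrow> real. (\<forall>\<eta>\<in>{0<..<1}. \<mu>0 \<eta> > 0) \<and>
    (\<forall>(n::nat) (h :: (nat \<Rightarrow> real) \<Rightarrow> real) (u :: (nat \<Rightarrow> real) \<Rightarrow> real) (r\<^sub>\<eta> :: real \<Rightarrow> real).
       n \<ge> 2 \<longrightarrow>
       rn_cont n (rn_ball n origin 1) h \<longrightarrow>
       bounded (h ` rn_ball n origin 1) \<longrightarrow>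
       (\<forall>x\<in>rn_ball n origin 1. h x \<le> 0) \<longrightarrow>
       rn_cont n (rn_ball n origin 1) u \<longrightarrow>
       (\<forall>x\<in>rn_ball n origin 1. u x \<ge> 0) \<longrightarrow>
       viscosity_solution n \<alpha> m h u \<longrightarrow>
       origin \<in> Euclidean_space n frontier_of positivity_set n u \<longrightarrow>
       origin \<in> Euclidean_space n closure_of (positivity_set n u \<inter> zero_set n h) \<longrightarrow>
       (\<forall>x0 \<in> positivity_set n u \<inter> zero_set n h.
          \<forall>x \<in> rn_ball n x0 (\<theta> * rn_norm n x0) \<inter> rn_ball n origin 1.
            0 \<ge> h x \<and>
            h x \<ge> - (s powr m) *
                  ((1 - \<theta>) powr \<alpha> - 64 * (1 + m) / (3 - m) ^ 4 * s powr (3 - m)) *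
                  rn_norm n x0 powr (3 * \<alpha> / (3 - m)) * rn_dist n x x0 powr (4 * m / (3 - m))) \<longrightarrow>
       (\<forall>\<eta>\<in>{0<..<1}. r\<^sub>\<eta> \<eta> \<in> {0<..<1} \<and>
          (\<forall>x \<in> rn_ball n origin (r\<^sub>\<eta> \<eta>).
             0 \<ge> h x \<and> h x \<ge> - \<mu>0 \<eta> * rn_norm n x powr ((3 * \<alpha> + 4 * m) / (3 - m)))) \<longrightarrow>
       (\<forall>\<eta>\<in>{0<..<1}. \<forall>r\<in>{0<..<r\<^sub>\<eta> \<eta>}.
          (SUP x\<in>rn_sphere n origin r. u x) \<ge>
            \<eta> * ((3 - m) ^ 4 / ((4 + \<alpha>) ^ 3 * (1 + \<alpha> + m))) powr (1 / (3 - m)) *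
            r powr ((4 + \<alpha>) / (3 - m))))"
proof -
  define \<beta> where "\<beta> = (4 + \<alpha>) / (3 - m)"
  define C where "C = ((3 - m) ^ 4 / ((4 + \<alpha>) ^ 3 * (1 + \<alpha> + m))) powr (1 / (3 - m))"
  define \<kappa> where "\<kappa> = s * (\<theta> / 2) powr (4 / (3 - m)) * 2 powr - \<beta>"
  define \<mu>0 where "\<mu>0 \<eta> = min \<kappa> (\<eta> * C) powr m * (1 - \<eta> powr (3 - m)) / 2" for \<eta>
  have d: "3 - m > 0" using assms by simp
  have \<beta>: "\<beta> > 1" using assms by (simp add: \<beta>_def)
  have \<beta>eq: "3 * \<beta> - 4 = \<alpha> + m * \<beta>" "(3 * \<alpha> + 4 * m) / (3 - m) = \<alpha> + m * \<beta>"
    using d by (simp_all add: \<beta>_def field_simps)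
  have C: "C > 0" using assms d by (simp add: C_def)
  have Ceq: "\<beta> ^ 3 * (\<beta> - 1) = C powr - (3 - m)"
  proof -
    have "\<beta> - 1 = (1 + \<alpha> + m) / (3 - m)" using d by (simp add: \<beta>_def field_simps)
    then have "\<beta> ^ 3 * (\<beta> - 1) = (4 + \<alpha>) ^ 3 * (1 + \<alpha> + m) / (3 - m) ^ 4"
      by (simp add: \<beta>_def power_divide power3_eq_cube power4_eq_xxxx)
    moreover have "C powr (3 - m) = (3 - m) ^ 4 / ((4 + \<alpha>) ^ 3 * (1 + \<alpha> + m))"
      using assms d by (simp add: C_def powr_powr)
    ultimately show ?thesis by (simp only: powr_minus inverse_divide)
  qed
  have \<kappa>: "\<kappa> > 0" using assms by (simp add: \<kappa>_def)
  have \<eta>lt: "\<eta> powr (3 - m) < 1" if "0 < \<eta>" "\<eta> < 1" for \<eta>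
    using powr_less_mono2[of "3 - m" \<eta> 1] d that by simp
  have \<mu>0: "\<mu>0 \<eta> > 0" if "\<eta> \<in> {0<..<1}" for \<eta>
    using \<eta>lt[of \<eta>] that \<kappa> C by (auto simp: \<mu>0_def min_def)
  have gap: "l ^ 3 * \<beta> ^ 3 * (\<beta> - 1) + \<mu>0 \<eta> < l powr m"
    if \<eta>: "\<eta> \<in> {0<..<1}" and l: "min \<kappa> (\<eta> * C) \<le> l" "l \<le> \<eta> * C" for \<eta> l
  proof -
    have mp: "min \<kappa> (\<eta> * C) > 0" using \<kappa> C \<eta> by auto
    then have lp: "l > 0" using l by linarith
    have "l ^ 3 = l powr m * l powr (3 - m)" using lp by (simp flip: powr_add)
    then have l3: "l ^ 3 * \<beta> ^ 3 * (\<beta> - 1) = l powr m * (l powr (3 - m) * C powr - (3 - m))"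
      by (simp add: mult.assoc Ceq)
    have "l powr (3 - m) * C powr - (3 - m) \<le> (\<eta> * C) powr (3 - m) * C powr - (3 - m)"
      using l lp d by (intro mult_right_mono powr_mono2) auto
    also have "\<dots> = \<eta> powr (3 - m)"
    proof -
      have "C powr (3 - m) * C powr - (3 - m) = 1" using C by (simp flip: powr_add)
      then show ?thesis by (simp only: powr_mult mult.assoc mult_1_right)
    qed
    finally have 1: "l ^ 3 * \<beta> ^ 3 * (\<beta> - 1) \<le> l powr m * \<eta> powr (3 - m)"
      unfolding l3 by (intro mult_left_mono) auto
    have "min \<kappa> (\<eta> * C) powr m \<le> l powr m"
      using mp l \<open>0 < m\<close> by (intro powr_mono2) auto
    then have "min \<kappa> (\<eta> * C) powr m * (1 - \<eta> powr (3 - m)) \<le> l powr m * (1 - \<eta> powr (3 - m))"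
      using \<eta>lt[of \<eta>] \<eta> by (intro mult_right_mono) auto
    then have "2 * \<mu>0 \<eta> \<le> l powr m - l powr m * \<eta> powr (3 - m)"
      by (simp add: \<mu>0_def right_diff_distrib)
    then show ?thesis using 1 \<mu>0[OF \<eta>] by linarith
  qed
  show ?thesis
  proof (intro exI[of _ \<mu>0] conjI ballI allI impI)
    fix \<eta> :: real assume "\<eta> \<in> {0<..<1}"
    then show "\<mu>0 \<eta> > 0" by (rule \<mu>0)
  next
    fix n :: nat and h u :: "(nat \<Rightarrow> real) \<Rightarrow> real" and R :: "real \<Rightarrow> real" and \<eta> r :: real
    assume hc: "rn_cont n (rn_ball n origin 1) h"
      and uc: "rn_cont n (rn_ball n origin 1) u"
      and sol: "viscosity_solution n \<alpha> m h u"
      and fr: "origin \<in> Euclidean_space n frontier_of positivity_set n u"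
      and cl: "origin \<in> Euclidean_space n closure_of (positivity_set n u \<inter> zero_set n h)"
      and hloc: "\<forall>x0 \<in> positivity_set n u \<inter> zero_set n h.
          \<forall>x \<in> rn_ball n x0 (\<theta> * rn_norm n x0) \<inter> rn_ball n origin 1.
            0 \<ge> h x \<and>
            h x \<ge> - (s powr m) *
                  ((1 - \<theta>) powr \<alpha> - 64 * (1 + m) / (3 - m) ^ 4 * s powr (3 - m)) *
                  rn_norm n x0 powr (3 * \<alpha> / (3 - m)) * rn_dist n x x0 powr (4 * m / (3 - m))"
      and hmu: "\<forall>\<eta>\<in>{0<..<1}. R \<eta> \<in> {0<..<1} \<and>
          (\<forall>x \<in> rn_ball n origin (R \<eta>).
             0 \<ge> h x \<and> h x \<ge> - \<mu>0 \<eta> * rn_norm n x powr ((3 * \<alpha> + 4 * m) / (3 - m)))"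
      and \<eta>: "\<eta> \<in> {0<..<1}" and r: "r \<in> {0<..<R \<eta>}"
    have sub: "viscosity_subsolution n \<alpha> m h u" using sol by (simp add: viscosity_solution_def)
    have "origin \<in> rn_ball n origin 1" by (simp add: rn_ball_def L2_set_def)
    then have u0: "u origin \<le> 0" by (rule nonpos_at_frontier_of_positivity_set[OF uc fr])
    have near: "\<exists>x\<in>rn_ball n origin \<delta>. x \<noteq> origin \<and> u x > \<kappa> * rn_norm n x powr \<beta>"
      if "\<delta> > 0" for \<delta>
      by (rule positive_near_origin[OF sub hc assms(1-6) u0 cl _ that])
         (use hloc in \<open>auto simp: \<kappa>_def \<beta>_def\<close>)
    have hb: "h x \<ge> - \<mu>0 \<eta> * rn_norm n x powr (\<alpha> + m * \<beta>)" if "x \<in> rn_ball n origin (R \<eta>)" for x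
      using hmu \<eta> that unfolding \<beta>eq(2) by blast
    have "\<eta> * C * r powr \<beta> \<le> (SUP x\<in>rn_sphere n origin r. u x)"
      by (rule subsolution_growth[OF sub u0 assms(2) \<beta> \<beta>eq(1) _ \<kappa> hb gap[OF \<eta>] near])
         (use \<eta> C r hmu in auto)
    then show "(SUP x\<in>rn_sphere n origin r. u x) \<ge>
            \<eta> * ((3 - m) ^ 4 / ((4 + \<alpha>) ^ 3 * (1 + \<alpha> + m))) powr (1 / (3 - m)) *
            r powr ((4 + \<alpha>) / (3 - m))"
      unfolding C_def \<beta>_def .
  qed
qed

end
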